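(* Let $X$ and $Y$ be Banach spaces such that $X$ has the metric lifting property and $Y$ has the metric extension property, and let $T \in \mathcal{L}(X,Y)$. Then $\delta_n(T^* ) = \delta_n(T)$ for all $n$.
   Context: $\mathcal{L}(X,Y)$ denotes the space of bounded linear operators between Banach spaces, with the operator norm; $T^* \in \mathcal{L}(Y^*,X^* )$ is the adjoint of $T$. Kolmogorov diameters: for Banach spaces $Z, W$, $R \in \mathcal{L}(Z,W)$ and an integer $n\ge 0$, $$\delta_n(R) = \inf\{\|Q_G R\| : G \subset W \text{ a linear subspace with } \dim G \le n\},$$ where $Q_G: W \to W/G$ is the canonical quotient map. Metric lifting property: a Banach space $X$ has it if for every Banach space $Z$, every closed subspace $F$ of $Z$, every $R \in \mathcal{L}(X, Z/F)$ and every $\epsilon > 0$, there exists $S \in \mathcal{L}(X,Z)$ with $\|S\| \le (1+\epsilon)\|R\|$ and $R = Q_F S$, where $Q_F : Z \to Z/F$ is the canonical quotient map. Metric extension property: a Banach space $Y$ has it if for every Banach space $Z$, every closed subspace $M$ of $Z$ and every $R \in \mathcal{L}(M,Y)$, there exists $S \in \mathcal{L}(Z,Y)$ with $R = S J_M$ and $\|S\| = \|R\|$, where $J_M : M \to Z$ is the canonical inclusion. *)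

theory Defs
  imports "HOL-Analysis.Analysis"
begin

text \<open>
  Spaces are records with an explicit carrier, because the two lifting and extension properties
  quantify over all Banach spaces, which cannot be done with the type class \<^class>\<open>banach\<close>.
  The scalars are an arbitrary \<^class>\<open>real_normed_field\<close>. By the Gelfand-Mazur theorem such a
  field is the real or the complex field, with the usual absolute value, so both kinds of Banach
  spaces are covered.
\<close>

record ('k, 'a) nspace =
  carrier :: "'a set"
  vzero :: 'a
  vadd :: "'a \<Rightarrow> 'a \<Rightarrow> 'a"
  vscale :: "'k \<Rightarrow> 'a \<Rightarrow> 'a"
  vnorm :: "'a \<Rightarrow> real"

locale normed_space =
  fixes X :: "('k::real_normed_field, 'a) nspace"
  assumes zero_closed: "vzero X \<in> carrier X"
    and add_closed: "\<lbrakk>x \<in> carrier X; y \<in> carrier X\<rbrakk> \<Longrightarrow> vadd X x y \<in> carrier X"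
    and scale_closed: "x \<in> carrier X \<Longrightarrow> vscale X c x \<in> carrier X"
    and add_assoc: "\<lbrakk>x \<in> carrier X; y \<in> carrier X; z \<in> carrier X\<rbrakk>
      \<Longrightarrow> vadd X (vadd X x y) z = vadd X x (vadd X y z)"
    and add_commute: "\<lbrakk>x \<in> carrier X; y \<in> carrier X\<rbrakk> \<Longrightarrow> vadd X x y = vadd X y x"
    and add_zero: "x \<in> carrier X \<Longrightarrow> vadd X x (vzero X) = x"
    and add_inverse: "x \<in> carrier X \<Longrightarrow> vadd X x (vscale X (-1) x) = vzero X"
    and scale_add_right: "\<lbrakk>x \<in> carrier X; y \<in> carrier X\<rbrakk>
      \<Longrightarrow> vscale X c (vadd X x y) = vadd X (vscale X c x) (vscale X c y)"
    and scale_add_left: "x \<in> carrier X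
      \<Longrightarrow> vscale X (c + d) x = vadd X (vscale X c x) (vscale X d x)"
    and scale_scale: "x \<in> carrier X \<Longrightarrow> vscale X c (vscale X d x) = vscale X (c * d) x"
    and scale_one: "x \<in> carrier X \<Longrightarrow> vscale X 1 x = x"
    and norm_eq_zero: "\<lbrakk>x \<in> carrier X; vnorm X x = 0\<rbrakk> \<Longrightarrow> x = vzero X"
    and norm_triangle: "\<lbrakk>x \<in> carrier X; y \<in> carrier X\<rbrakk>
      \<Longrightarrow> vnorm X (vadd X x y) \<le> vnorm X x + vnorm X y"
    and norm_scale: "x \<in> carrier X \<Longrightarrow> vnorm X (vscale X c x) = norm c * vnorm X x"

text \<open>
  The value 0 outside the carrier is needed for \<^locale>\<open>Metric_space\<close>, whose axioms ask for
  nonnegativity and symmetry at all points of the type.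
\<close>

definition vdist :: "('k::real_normed_field, 'a) nspace \<Rightarrow> 'a \<Rightarrow> 'a \<Rightarrow> real" where
  "vdist X x y =
    (if x \<in> carrier X \<and> y \<in> carrier X then vnorm X (vadd X x (vscale X (-1) y)) else 0)"

definition banach_space :: "('k::real_normed_field, 'a) nspace \<Rightarrow> bool" where
  "banach_space X \<longleftrightarrow> normed_space X \<and> Metric_space.mcomplete (carrier X) (vdist X)"

definition lin_subspace :: "'a set \<Rightarrow> ('k::real_normed_field, 'a) nspace \<Rightarrow> bool" where
  "lin_subspace F X \<longleftrightarrow> F \<subseteq> carrier X \<and> vzero X \<in> F \<and>
    (\<forall>x\<in>F. \<forall>y\<in>F. vadd X x y \<in> F) \<and> (\<forall>c. \<forall>x\<in>F. vscale X c x \<in> F)"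

definition closed_subspace :: "'a set \<Rightarrow> ('k::real_normed_field, 'a) nspace \<Rightarrow> bool" where
  "closed_subspace F X \<longleftrightarrow>
    lin_subspace F X \<and> closedin (Metric_space.mtopology (carrier X) (vdist X)) F"

definition lin_span :: "('k::real_normed_field, 'a) nspace \<Rightarrow> 'a set \<Rightarrow> 'a set" where
  "lin_span X B = \<Inter>{F. lin_subspace F X \<and> B \<subseteq> F}"

definition lin_basis :: "('k::real_normed_field, 'a) nspace \<Rightarrow> 'a set \<Rightarrow> 'a set \<Rightarrow> bool" where
  "lin_basis X G B \<longleftrightarrow> B \<subseteq> G \<and> lin_span X B = G \<and> (\<forall>b\<in>B. b \<notin> lin_span X (B - {b}))"

definition has_dim_at_most :: "('k::real_normed_field, 'a) nspace \<Rightarrow> 'a set \<Rightarrow> nat \<Rightarrow> bool" where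
  "has_dim_at_most X G n \<longleftrightarrow> (\<exists>B. lin_basis X G B \<and> finite B \<and> card B \<le> n)"

definition sub_nspace :: "('k::real_normed_field, 'a) nspace \<Rightarrow> 'a set \<Rightarrow> ('k, 'a) nspace" where
  "sub_nspace X M = X\<lparr>carrier := M\<rparr>"

definition quot_map :: "('k::real_normed_field, 'a) nspace \<Rightarrow> 'a set \<Rightarrow> 'a \<Rightarrow> 'a set" where
  "quot_map X F x = (\<lambda>f. vadd X x f) ` F"

text \<open>
  In the scalar multiple of a coset the summand \<open>F\<close> matters only for the scalar 0, where the
  pointwise multiple would be a singleton instead of \<open>F\<close>.
\<close>

definition quot_space :: "('k::real_normed_field, 'a) nspace \<Rightarrow> 'a set \<Rightarrow> ('k, 'a set) nspace" where
  "quot_space X F =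
    \<lparr>carrier = quot_map X F ` carrier X,
     vzero = F,
     vadd = (\<lambda>A B. {vadd X a b | a b. a \<in> A \<and> b \<in> B}),
     vscale = (\<lambda>c A. {vadd X (vscale X c a) f | a f. a \<in> A \<and> f \<in> F}),
     vnorm = (\<lambda>A. Inf (vnorm X ` A))\<rparr>"

definition bounded_ops ::
  "('k::real_normed_field, 'a) nspace \<Rightarrow> ('k, 'b) nspace \<Rightarrow> ('a \<Rightarrow> 'b) set" where
  "bounded_ops X Y = {T. T \<in> carrier X \<rightarrow> carrier Y \<and>
    (\<forall>x\<in>carrier X. \<forall>y\<in>carrier X. T (vadd X x y) = vadd Y (T x) (T y)) \<and>
    (\<forall>c. \<forall>x\<in>carrier X. T (vscale X c x) = vscale Y c (T x)) \<and>
    (\<exists>C. \<forall>x\<in>carrier X. vnorm Y (T x) \<le> C * vnorm X x)}"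

definition op_norm ::
  "('k::real_normed_field, 'a) nspace \<Rightarrow> ('k, 'b) nspace \<Rightarrow> ('a \<Rightarrow> 'b) \<Rightarrow> real" where
  "op_norm X Y T = Sup {vnorm Y (T x) | x. x \<in> carrier X \<and> vnorm X x \<le> 1}"

definition scalar_space :: "('k::real_normed_field, 'k) nspace" where
  "scalar_space = \<lparr>carrier = UNIV, vzero = 0, vadd = (+), vscale = (*), vnorm = norm\<rparr>"

text \<open>
  Functionals vanish outside the carrier, so that each functional on the space is represented by
  exactly one function on the type.
\<close>

definition dual_space :: "('k::real_normed_field, 'a) nspace \<Rightarrow> ('k, 'a \<Rightarrow> 'k) nspace" where
  "dual_space X =
    \<lparr>carrier = {f \<in> bounded_ops X scalar_space. \<forall>x. x \<notin> carrier X \<longrightarrow> f x = 0},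
     vzero = (\<lambda>x. 0),
     vadd = (\<lambda>f g x. f x + g x),
     vscale = (\<lambda>c f x. c * f x),
     vnorm = op_norm X scalar_space\<rparr>"

definition adjoint_op ::
  "('k::real_normed_field, 'a) nspace \<Rightarrow> ('a \<Rightarrow> 'b) \<Rightarrow> ('b \<Rightarrow> 'k) \<Rightarrow> ('a \<Rightarrow> 'k)" where
  "adjoint_op X T g = (\<lambda>x. if x \<in> carrier X then g (T x) else 0)"

definition kolmogorov_diameter ::
  "nat \<Rightarrow> ('k::real_normed_field, 'a) nspace \<Rightarrow> ('k, 'b) nspace \<Rightarrow> ('a \<Rightarrow> 'b) \<Rightarrow> real" where
  "kolmogorov_diameter n Z W R =
    Inf {op_norm Z (quot_space W G) (quot_map W G \<circ> R) | G. lin_subspace G W \<and> has_dim_at_most W G n}"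

text \<open>
  A formula of HOL can only quantify over spaces \<open>Z\<close> whose carriers lie in one given type. Here
  this type is the one that contains the space itself, and it may be as large as desired.
\<close>

definition metric_lifting_property :: "('k::real_normed_field, 'a) nspace \<Rightarrow> bool" where
  "metric_lifting_property X \<longleftrightarrow>
    (\<forall>(Z :: ('k, 'a) nspace) F R \<epsilon>.
      banach_space Z \<and> closed_subspace F Z \<and> R \<in> bounded_ops X (quot_space Z F) \<and> 0 < \<epsilon> \<longrightarrow>
      (\<exists>S \<in> bounded_ops X Z.
        op_norm X Z S \<le> (1 + \<epsilon>) * op_norm X (quot_space Z F) R \<and>
        (\<forall>x\<in>carrier X. R x = quot_map Z F (S x))))"

definition metric_extension_property :: "('k::real_normed_field, 'a) nspace \<Rightarrow> bool" where
  "metric_extension_property Y \<longleftrightarrow>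
    (\<forall>(Z :: ('k, 'a) nspace) M R.
      banach_space Z \<and> closed_subspace M Z \<and> R \<in> bounded_ops (sub_nspace Z M) Y \<longrightarrow>
      (\<exists>S \<in> bounded_ops Z Y.
        (\<forall>x\<in>M. R x = S x) \<and>
        op_norm Z Y S = op_norm (sub_nspace Z M) Y R))"

end

theory Submission
  imports Defs "HOL-Computational_Algebra.Fundamental_Theorem_Algebra"
begin

text \<open>
  Both diameters equal the distance of \<open>T\<close> to the operators of rank at most \<open>n\<close>. A subspace \<open>H\<close> of
  \<open>X*\<close> of dimension at most \<open>n\<close> is the annihilator of its common kernel \<open>M\<close>, and by Hahn-Banach the
  restriction of \<open>T\<close> to \<open>M\<close> has norm at most that of \<open>Q_H T*\<close>. The extension property gives \<open>S\<close> on \<open>X\<close>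
  with the same norm that agrees with \<open>T\<close> on \<open>M\<close>, so that \<open>T - S\<close> has rank at most \<open>n\<close>. Conversely a lifting
  \<open>S\<close> of \<open>Q_G T\<close> differs from \<open>T\<close> by an operator into \<open>G\<close>, and the range of \<open>(T - S)*\<close> has dimension at
  most that of \<open>G\<close>.

  Hahn-Banach and the closedness of finite-dimensional subspaces need that the scalars are the real
  or the complex field. This is proved by Ostrowski's elementary argument: if the minimum \<open>m\<close> of
  \<open>\<parallel>a\<^sup>2 - u a + v\<parallel>\<close> over \<open>u\<^sup>2 \<le> 4 v\<close> were positive, take a minimal quadratic \<open>q\<close> with \<open>v\<close> maximal and
  \<open>0 < e < m\<close>. Since \<open>q + e\<close> divides \<open>q^N - (-e)^N\<close> and the cofactor is a product of linear and
  quadratic factors, \<open>\<parallel>q + e\<parallel> \<le> m + m (e/m)^N\<close> for all \<open>N \<ge> 1\<close>, against the choice of \<open>v\<close>.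
\<close>

section \<open>The scalar field\<close>

definition poly_at :: "'k::real_normed_field \<Rightarrow> real poly \<Rightarrow> 'k" where
  "poly_at a p = poly (map_poly of_real p) a"

lemma poly_at_pCons: "poly_at a (pCons c p) = of_real c + a * poly_at a p"
  by (simp add: poly_at_def map_poly_pCons)

lemma poly_at_0: "poly_at a 0 = 0"
  by (simp add: poly_at_def)

lemma poly_at_add: "poly_at a (p + q) = poly_at a p + poly_at a q"
  by (induction p q rule: poly_induct2) (simp_all add: poly_at_pCons poly_at_0 algebra_simps)

lemma poly_at_smult: "poly_at a (smult c p) = of_real c * poly_at a p"
  by (induction p) (simp_all add: poly_at_pCons poly_at_0 algebra_simps)

lemma poly_at_mult: "poly_at a (p * q) = poly_at a p * poly_at a q"
  by (induction p)
    (simp_all add: poly_at_pCons poly_at_0 poly_at_add poly_at_smult algebra_simps)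

lemma poly_at_power: "poly_at a (p ^ n) = poly_at a p ^ n"
proof (induction n)
  case 0
  show ?case by (simp add: one_pCons poly_at_pCons poly_at_0)
qed (simp add: poly_at_mult)

lemmas poly_at_simps = poly_at_pCons poly_at_0 poly_at_add poly_at_smult poly_at_mult poly_at_power

text \<open>The fundamental theorem of algebra gives a complex root \<open>z\<close>. If it is real,
  a linear factor splits off. Otherwise \<open>p\<close> is divided by \<open>d\<close>, the real
  quadratic with roots \<open>z\<close> and its conjugate: the remainder is real, of degree below 2,
  and vanishes at the nonreal \<open>z\<close>, so it is zero.\<close>

lemma real_poly_quadratic_factor:
  fixes p :: "real poly"
  assumes "degree p \<noteq> 0"
  obtains r q where "p = [:- r, 1:] * q" | u v q where "u\<^sup>2 \<le> 4 * v" "p = [:v, - u, 1:] * q"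
proof -
  have "degree (map_poly complex_of_real p) \<noteq> 0"
    using assms by (simp add: degree_map_poly)
  then obtain z :: complex where z: "poly_at z p = 0"
    using fundamental_theorem_of_algebra[of "map_poly complex_of_real p"]
    unfolding poly_at_def constant_degree by blast
  show thesis
  proof (cases "Im z = 0")
    case True
    then have "z = of_real (Re z)" by (simp add: complex_eq_iff)
    moreover have "poly_at (of_real r) p = complex_of_real (poly p r)" for r
      by (induction p) (simp_all add: poly_at_simps)
    ultimately have "poly p (Re z) = 0" using z by (metis of_real_eq_0_iff)
    then show thesis using that(1) by (metis dvdE poly_eq_0_iff_dvd)
  next
    case False
    define d where "d = [:(cmod z)\<^sup>2, - (2 * Re z), 1:]"
    have dz: "poly_at z d = 0"
      by (simp add: d_def poly_at_simps complex_eq_iff cmod_power2)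
        (simp add: power2_eq_square algebra_simps)
    define s where "s = p mod d"
    have "degree s < 2"
      using degree_mod_less'[of d p] unfolding s_def by (cases "p mod d = 0") (auto simp: d_def)
    then have s: "s = [:coeff s 0, coeff s 1:]"
      by (intro poly_eqI) (auto simp: coeff_pCons coeff_eq_0 split: nat.splits)
    define q where "q = p div d"
    have p: "p = d * q + s" by (simp add: s_def q_def)
    have "poly_at z s = 0" using z dz by (simp add: p poly_at_add poly_at_mult)
    then have "of_real (coeff s 0) + z * of_real (coeff s 1) = 0"
      by (subst (asm) s) (simp add: poly_at_simps)
    then have "coeff s 1 = 0 \<and> coeff s 0 = 0" using False by (auto simp: complex_eq_iff)
    then have "s = 0" using s by simp
    moreover have "(2 * Re z)\<^sup>2 \<le> 4 * (cmod z)\<^sup>2" by (simp add: cmod_power2 algebra_simps)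
    ultimately show thesis using that(2)[of "2 * Re z" "(cmod z)\<^sup>2" q] p
      by (simp add: d_def)
  qed
qed

text \<open>Each degree contributes one factor \<open>m\<close> to the squared norm: a quadratic
  factor has squared norm at least \<open>m^2\<close>, and the square of a linear factor is itself
  an admissible quadratic, the case \<open>u^2 = 4 * v\<close>, so its norm is at least
  \<open>m\<close>.\<close>

lemma norm_poly_at_ge:
  fixes a :: "'k::real_normed_field"
  assumes m: "\<And>u v. u\<^sup>2 \<le> 4 * v \<Longrightarrow> m \<le> norm (poly_at a [:v, - u, 1:])" and "0 \<le> m"
  shows "lead_coeff p = 1 \<Longrightarrow> m ^ degree p \<le> (norm (poly_at a p))\<^sup>2"
proof (induction "degree p" arbitrary: p rule: less_induct)
  case less
  show ?case
  proof (cases "degree p = 0")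
    case True
    then have "p = 1" using less.prems by (metis degree_0_id one_pCons)
    then show ?thesis by (simp add: one_pCons poly_at_simps)
  next
    case False
    from real_poly_quadratic_factor[OF False] show ?thesis
    proof cases
      case (1 r q)
      with less.prems have q: "lead_coeff q = 1"
        by (simp only: lead_coeff_mult) simp
      then have "q \<noteq> 0" by auto
      then have "degree ([:- r, 1:] * q) = degree [:- r, 1:] + degree q"
        by (intro degree_mult_eq) auto
      then have deg: "degree p = Suc (degree q)" unfolding 1 by simp
      have "m \<le> norm (poly_at a [:r\<^sup>2, - (2 * r), 1:])" by (rule m) (simp add: power2_eq_square)
      also have "poly_at a [:r\<^sup>2, - (2 * r), 1:] = (poly_at a [:- r, 1:])\<^sup>2"
        by (simp add: poly_at_simps power2_eq_square algebra_simps)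
      finally have "m * m ^ degree q \<le> (norm (poly_at a [:- r, 1:]))\<^sup>2 * (norm (poly_at a q))\<^sup>2"
        using less.hyps[of q] deg q \<open>0 \<le> m\<close> by (intro mult_mono) (auto simp: norm_power)
      moreover have "poly_at a p = poly_at a [:- r, 1:] * poly_at a q"
        unfolding 1 by (rule poly_at_mult)
      ultimately show ?thesis unfolding deg by (simp add: norm_mult power_mult_distrib)
    next
      case (2 u v q)
      with less.prems have q: "lead_coeff q = 1"
        by (simp only: lead_coeff_mult) simp
      then have "q \<noteq> 0" by auto
      then have "degree ([:v, - u, 1:] * q) = degree [:v, - u, 1:] + degree q"
        by (intro degree_mult_eq) auto
      then have deg: "degree p = Suc (Suc (degree q))" unfolding 2 by simp
      have "m\<^sup>2 * m ^ degree q \<le> (norm (poly_at a [:v, - u, 1:]))\<^sup>2 * (norm (poly_at a q))\<^sup>2"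
        using less.hyps[of q] deg q \<open>0 \<le> m\<close> m[OF 2(1)] by (intro mult_mono power_mono) auto
      moreover have "poly_at a p = poly_at a [:v, - u, 1:] * poly_at a q"
        unfolding 2 by (rule poly_at_mult)
      ultimately show ?thesis unfolding deg
        by (simp add: norm_mult power_mult_distrib power2_eq_square mult_ac)
    qed
  qed
qed

section \<open>Ostrowski's minimum argument for quadratics of nonpositive discriminant\<close>

lemma quadratic_norm_attains_min:
  fixes a :: "'k::real_normed_field"
  defines "f \<equiv> \<lambda>w. norm (poly_at a [:snd w, - fst w, 1:])"
  obtains w where "(fst w)\<^sup>2 \<le> 4 * snd w"
    "\<And>w'. (fst w')\<^sup>2 \<le> 4 * snd w' \<Longrightarrow> f w \<le> f w'"
    "\<And>w'. \<lbrakk>(fst w')\<^sup>2 \<le> 4 * snd w'; f w' = f w\<rbrakk> \<Longrightarrow> snd w' \<le> snd w"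
proof -
  define D where "D = {w::real \<times> real. (fst w)\<^sup>2 \<le> 4 * snd w}"
  have f: "f w = norm (of_real (snd w) + a * (a - of_real (fst w)))" for w
    by (simp add: f_def poly_at_simps algebra_simps)
  have cont: "continuous_on S f" for S
    unfolding f by (intro continuous_intros)
  \<comment> \<open>With \<open>t = sqrt (snd w)\<close> the constraint gives
    \<open>f w \<ge> t^2 - (norm a)^2 - 2 * t * norm a\<close>. Beyond \<open>V\<close> one has
    \<open>8 * (norm a)^2 < t^2\<close>, and then this bound exceeds
    \<open>(norm a)^2 = f (0, 0)\<close>.\<close>
  define V where "V = 8 * (norm a + 1)\<^sup>2"
  have large: "f (0, 0) < f w" if "w \<in> D" "V < snd w" for w
  proof -
    let ?u = "fst w" and ?v = "snd w"
    define t where "t = sqrt ?v"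
    have "0 < norm a + 1" by (simp add: add_nonneg_pos)
    then have "0 < V" by (simp add: V_def)
    then have v: "0 < ?v" using that by simp
    have t: "t\<^sup>2 = ?v" "0 \<le> t" using v by (auto simp: t_def)
    have "?u\<^sup>2 \<le> (2 * t)\<^sup>2" using that t by (simp add: D_def power_mult_distrib)
    then have u: "\<bar>?u\<bar> \<le> 2 * t" using abs_le_square_iff[of ?u "2 * t"] t by simp
    have "norm (a * (a - of_real ?u)) \<le> norm a * (norm a + \<bar>?u\<bar>)"
      by (metis norm_mult mult_left_mono norm_ge_zero norm_of_real norm_triangle_ineq4)
    also have "\<dots> \<le> norm a * (norm a + 2 * t)" using u by (intro mult_left_mono) auto
    finally have "norm (a * (a - of_real ?u)) \<le> (norm a)\<^sup>2 + 2 * t * norm a"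
      by (simp add: algebra_simps power2_eq_square)
    moreover have "?v \<le> f w + norm (a * (a - of_real ?u))"
      using norm_triangle_ineq2[of "of_real ?v" "- (a * (a - of_real ?u))"] v by (simp add: f)
    moreover have "2 * (norm a)\<^sup>2 + 2 * t * norm a < t\<^sup>2"
    proof -
      have "8 * (norm a)\<^sup>2 \<le> V" by (simp add: V_def power_mono)
      then have "8 * (norm a)\<^sup>2 < t\<^sup>2" using that t(1) by linarith
      moreover have "2 * t * norm a \<le> t\<^sup>2 / 2 + 2 * (norm a)\<^sup>2"
        using zero_le_power2[of "t - 2 * norm a"] by (simp add: power2_eq_square algebra_simps)
      ultimately show ?thesis by linarith
    qed
    moreover have "f (0, 0) = (norm a)\<^sup>2" by (simp add: f norm_mult power2_eq_square)
    ultimately show ?thesis using t(1) by linarith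
  qed
  define K where "K = D \<inter> {w. snd w \<le> V}"
  have "closed K"
    unfolding K_def D_def Collect_conj_eq[symmetric]
    by (intro closed_Collect_conj closed_Collect_le continuous_intros)
  \<comment> \<open>The first coordinate \<open>u\<close> satisfies
    \<open>\<bar>u\<bar> \<le> 1 + u^2 \<le> 1 + 4 * V\<close>.\<close>
  moreover have "K \<subseteq> cbox (- (1 + 4 * V), 0) (1 + 4 * V, V)"
  proof
    fix w assume "w \<in> K"
    then have w: "(fst w)\<^sup>2 \<le> 4 * snd w" "snd w \<le> V" by (auto simp: K_def D_def)
    then have "0 \<le> snd w" using zero_le_power2[of "fst w"] by linarith
    moreover have "\<bar>fst w\<bar> \<le> 1 + (fst w)\<^sup>2"
      using zero_le_power2[of "\<bar>fst w\<bar> - 1"] zero_le_power2[of "fst w"]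
      by (simp add: power2_eq_square algebra_simps)
    ultimately show "w \<in> cbox (- (1 + 4 * V), 0) (1 + 4 * V, V)"
      using w by (cases w) (auto simp: cbox_Pair_eq)
  qed
  ultimately have "compact K"
    using compact_eq_bounded_closed bounded_subset[OF bounded_cbox] by blast
  have "0 \<le> V" by (simp add: V_def)
  then have "(0, 0) \<in> K" by (simp add: K_def D_def)
  then obtain w0 where w0: "w0 \<in> K" "\<And>w. w \<in> K \<Longrightarrow> f w0 \<le> f w"
    using continuous_attains_inf[OF \<open>compact K\<close> _ cont] by blast
  \<comment> \<open>The minimizers of \<open>f\<close> on \<open>K\<close> form a compact set, so
    one of them has the largest second coordinate.\<close>
  define L where "L = K \<inter> {w. f w \<le> f w0}"
  have "closed {w. f w \<le> f w0}"
    by (intro closed_Collect_le cont) (intro continuous_intros)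
  then have "compact L" using \<open>compact K\<close> by (simp add: L_def compact_Int_closed)
  moreover have "w0 \<in> L" using w0 by (simp add: L_def)
  ultimately obtain w where w: "w \<in> L" "\<And>w'. w' \<in> L \<Longrightarrow> snd w' \<le> snd w"
    using continuous_attains_sup[of L snd] continuous_on_snd[OF continuous_on_id] by blast
  have fw: "f w = f w0" using w(1) w0(2)[of w] by (simp add: L_def)
  have min: "f w \<le> f w'" if "w' \<in> D" for w'
  proof (cases "snd w' \<le> V")
    case True
    then show ?thesis using w0(2)[of w'] that by (simp add: fw K_def)
  next
    case False
    then have "f (0, 0) < f w'" using large[OF that] by simp
    with w0(2)[OF \<open>(0, 0) \<in> K\<close>] show ?thesis by (simp add: fw)
  qed
  have "snd w' \<le> snd w" if "w' \<in> D" "f w' = f w" for w'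
  proof -
    have "\<not> V < snd w'" using large[OF that(1)] that(2) min[of "(0, 0)"] by (auto simp: D_def)
    then have "w' \<in> L" using that fw by (simp add: L_def K_def)
    then show ?thesis by (rule w)
  qed
  moreover have "w \<in> D" using w(1) by (simp add: L_def K_def)
  ultimately show thesis using min that[of w] unfolding D_def by blast
qed

text \<open>If the minimum \<open>m\<close> were positive, raising the constant term of the
  minimizer by \<open>e\<close> would again give the value \<open>m\<close>, although the minimizer
  was chosen with the largest constant term. So the minimum is zero and the minimizer is the desired
  quadratic.\<close>

lemma real_quadratic_root:
  fixes a :: "'k::real_normed_field"
  obtains u v where "u\<^sup>2 \<le> 4 * v" "poly_at a [:v, - u, 1:] = 0"
proof -
  obtain w where w: "(fst w)\<^sup>2 \<le> 4 * snd w"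
    "\<And>w'. (fst w')\<^sup>2 \<le> 4 * snd w' \<Longrightarrow>
      norm (poly_at a [:snd w, - fst w, 1:]) \<le> norm (poly_at a [:snd w', - fst w', 1:])"
    "\<And>w'. \<lbrakk>(fst w')\<^sup>2 \<le> 4 * snd w';
      norm (poly_at a [:snd w', - fst w', 1:]) = norm (poly_at a [:snd w, - fst w, 1:])\<rbrakk>
      \<Longrightarrow> snd w' \<le> snd w"
    using quadratic_norm_attains_min[of a] by blast
  define q where "q = [:snd w, - fst w, 1:]"
  define m where "m = norm (poly_at a q)"
  have m_le: "m \<le> norm (poly_at a [:v, - u, 1:])" if "u\<^sup>2 \<le> 4 * v" for u v
    using w(2)[of "(u, v)"] that by (simp add: m_def q_def)
  have "m = 0"
  proof (rule ccontr)
    assume "m \<noteq> 0"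
    then have "0 < m" by (simp add: m_def)
    \<comment> \<open>Positivity raises the constant term and keeps the quadratic admissible;
      \<open>e < m\<close> makes \<open>(e / m) ^ N\<close> tend to zero.\<close>
    define e where "e = m / 2"
    have e: "0 < e" "e < m" using \<open>0 < m\<close> by (auto simp: e_def)
    define qe where "qe = [:snd w + e, - fst w, 1:]"
    have qe: "q + [:e:] = qe" by (simp add: q_def qe_def)
    have "norm (poly_at a qe) \<le> m + m * (e / m) ^ Suc n" for n
    proof -
      define N where "N = Suc n"
      \<comment> \<open>The cofactor of \<open>q + e\<close> in \<open>q ^ N - (- e) ^ N\<close>. It
        is monic of degree \<open>2 * n\<close>, so its value at \<open>a\<close> has norm at least
        \<open>m ^ n\<close>.\<close>
      define p where "p = (\<Sum>i<N. [:- e:] ^ (N - Suc i) * q ^ i)"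
      have p: "q ^ N - [:- e:] ^ N = qe * p"
        unfolding p_def qe[symmetric] power_diff_sumr2 by simp
      have c: "[:- e:] ^ N = [:(- e) ^ N:]" by (induction N) (simp_all add: one_pCons)
      have lq: "lead_coeff q = 1" by (simp add: q_def)
      have degqN: "degree (q ^ N) = 2 * N" by (subst degree_power_eq) (auto simp: q_def)
      have deg: "degree (q ^ N - [:(- e) ^ N:]) = 2 * N"
        using degqN by (subst diff_conv_add_uminus, subst degree_add_eq_left) (auto simp: N_def)
      have "lead_coeff (q ^ N - [:(- e) ^ N:]) = lead_coeff (q ^ N)"
        unfolding deg degqN by (simp add: N_def)
      also have "\<dots> = 1" by (simp add: lead_coeff_power lq)
      finally have lp: "lead_coeff p = 1"
        unfolding p[unfolded c] lead_coeff_mult by (simp add: qe_def)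
      then have "p \<noteq> 0" by auto
      then have "degree (qe * p) = 2 + degree p"
        by (subst degree_mult_eq) (auto simp: qe_def)
      then have "2 + degree p = 2 * N" using deg unfolding p[symmetric] c by simp
      then have dp: "degree p = 2 * n" by (simp add: N_def)
      have "(m ^ n)\<^sup>2 \<le> (norm (poly_at a p))\<^sup>2"
        using norm_poly_at_ge[of m a p, OF m_le _ lp] \<open>0 < m\<close> dp
        by (simp add: power_mult[symmetric] mult.commute)
      then have "m ^ n \<le> norm (poly_at a p)" by (rule power2_le_imp_le) simp
      then have "norm (poly_at a qe) * m ^ n \<le> norm (poly_at a (qe * p))"
        by (simp add: poly_at_mult norm_mult mult_left_mono)
      also have "\<dots> = norm (poly_at a q ^ N - of_real ((- e) ^ N))"
        unfolding p[symmetric] c diff_conv_add_uminus[of "q ^ N"]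
        by (simp add: poly_at_simps)
      also have "\<dots> \<le> m ^ N + e ^ N"
        using norm_triangle_ineq4[of "poly_at a q ^ N" "of_real ((- e) ^ N)"] e
        by (simp add: m_def norm_power power_abs del: of_real_power)
      finally have "norm (poly_at a qe) \<le> (m ^ N + e ^ N) / m ^ n"
        using \<open>0 < m\<close> by (simp add: field_simps)
      also have "\<dots> = m + m * (e / m) ^ N"
        using \<open>0 < m\<close> by (simp add: N_def field_simps)
      finally show ?thesis by (simp add: N_def)
    qed
    moreover have "(\<lambda>n. m + m * (e / m) ^ Suc n) \<longlonglongrightarrow> m + m * 0"
      using e by (intro tendsto_intros LIMSEQ_Suc LIMSEQ_realpow_zero) auto
    ultimately have "norm (poly_at a qe) \<le> m + m * 0"
      by (intro LIMSEQ_le_const) auto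
    moreover have "m \<le> norm (poly_at a qe)"
      using m_le[of "fst w" "snd w + e"] w(1) e by (simp add: qe_def)
    ultimately have "norm (poly_at a qe) = m" by simp
    then show False
      using w(3)[of "(fst w, snd w + e)"] w(1) e by (simp add: qe_def q_def m_def)
  qed
  then show thesis using that[OF w(1)] by (simp add: m_def q_def)
qed

section \<open>The scalar field is the real or the complex field\<close>

lemma real_or_complex_field:
  "(\<forall>x::'k::real_normed_field. x \<in> range of_real) \<or>
    (\<exists>j::'k. j\<^sup>2 = -1 \<and> (\<forall>x. \<exists>a b. x = of_real a + of_real b * j))"
proof -
  \<comment> \<open>Completing the square in the real quadratic of \<open>x\<close> gives
    \<open>y^2 = - s^2\<close>, where \<open>s\<close> is a genuine square root because the
    discriminant is not positive. Since \<open>x\<close> is not real, \<open>y\<close> and hence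
    \<open>s\<close> are nonzero, and \<open>y / s\<close> is a square root of -1.\<close>
  have rep: "\<exists>r s j. x = of_real r + of_real s * j \<and> j\<^sup>2 = (-1 :: 'k)" if "x \<notin> range of_real" for x :: 'k
  proof -
    obtain u v where uv: "u\<^sup>2 \<le> 4 * v" "poly_at x [:v, - u, 1:] = 0"
      by (rule real_quadratic_root)
    define h where "h = u / 2"
    have u: "u = 2 * h" by (simp add: h_def)
    define s where "s = sqrt (v - h\<^sup>2)"
    define y where "y = x - of_real h"
    have s2: "s\<^sup>2 = v - h\<^sup>2" using uv by (simp add: s_def u power_mult_distrib)
    have eq: "y\<^sup>2 = - of_real (s\<^sup>2)"
      using uv(2) unfolding s2 u by (simp add: y_def poly_at_simps power2_eq_square algebra_simps)
    have "y \<noteq> 0" using that unfolding y_def by (metis diff_add_cancel add_0 rangeI)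
    then have "s \<noteq> 0" using eq by auto
    then have "(y / of_real s)\<^sup>2 = -1" using eq by (simp add: power_divide)
    moreover have "x = of_real h + of_real s * (y / of_real s)"
      using \<open>s \<noteq> 0\<close> by (simp add: y_def)
    ultimately show ?thesis by blast
  qed
  show ?thesis
  proof (cases "\<forall>x::'k. x \<in> range of_real")
    case True
    then show ?thesis by blast
  next
    case False
    then obtain j :: 'k where j: "j\<^sup>2 = -1" using rep by blast
    have "\<exists>a b. x = of_real a + of_real b * j" for x
    proof (cases "x \<in> range of_real")
      case True
      then obtain a where "x = of_real a" by auto
      then have "x = of_real a + of_real 0 * j" by simp
      then show ?thesis by blast
    next
      case False
      then obtain r s i where x: "x = of_real r + of_real s * i" "i\<^sup>2 = -1" using rep by blast
      \<comment> \<open>A field has no square roots of -1 beyond \<open>j\<close> and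
        \<open>- j\<close>, so the root belonging to \<open>x\<close> can be exchanged for the fixed
        \<open>j\<close>.\<close>
      then have "i = j \<or> i = - j" using j power2_eq_iff by metis
      then have "x = of_real r + of_real s * j \<or> x = of_real r + of_real (- s) * j" using x by auto
      then show ?thesis by blast
    qed
    then show ?thesis using j by blast
  qed
qed

text \<open>No formula for the norm in terms of real coordinates is available at this point. It
  suffices that the ball is closed and contained in the continuous image of a compact ball of the
  plane.\<close>

lemma compact_cball_field: "compact (cball (0::'k::real_normed_field) r)"
proof -
  obtain g :: "real \<times> real \<Rightarrow> 'k" and R where g: "continuous_on UNIV g" "cball 0 r \<subseteq> g ` cball 0 R"
    using real_or_complex_field[where 'k = 'k]
  proof (elim disjE exE conjE)
    assume 1: "\<forall>x::'k. x \<in> range of_real"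
    have "cball (0::'k) r \<subseteq> (\<lambda>w. of_real (fst w)) ` cball (0 :: real \<times> real) r"
    proof
      fix x :: 'k assume x: "x \<in> cball 0 r"
      obtain a where "x = of_real a" using 1 by blast
      with x show "x \<in> (\<lambda>w. of_real (fst w)) ` cball (0 :: real \<times> real) r"
        by (intro image_eqI[of _ _ "(a, 0)"]) (auto simp: norm_Pair)
    qed
    then show thesis by (rule that[rotated]) (intro continuous_intros)
  next
    fix j :: 'k
    assume 2: "j\<^sup>2 = -1" "\<forall>x. \<exists>a b. x = of_real a + of_real b * j"
    \<comment> \<open>The coordinates of \<open>x = a + b * j\<close> are controlled by multiplying
      with the conjugate: \<open>a^2 + b^2 \<le> norm x * (\<bar>a\<bar> + \<bar>b\<bar>)\<close>,
      and \<open>(\<bar>a\<bar> + \<bar>b\<bar>)^2 \<le> 2 * (a^2 + b^2)\<close>. This explains the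
      radius \<open>2 * r\<close>.\<close>
    have "cball (0::'k) r \<subseteq> (\<lambda>w. of_real (fst w) + of_real (snd w) * j) ` cball (0 :: real \<times> real) (2 * r)"
    proof
      fix x :: 'k assume x: "x \<in> cball 0 r"
      obtain a b where ab: "x = of_real a + of_real b * j" using 2 by blast
      have nj: "norm j = 1" using 2(1) by (metis norm_minus_cancel norm_one norm_power power2_eq_1_iff norm_ge_zero abs_norm_cancel abs_1 abs_minus_cancel real_sqrt_abs)
      have "norm (of_real a - of_real b * j) \<le> \<bar>a\<bar> + \<bar>b\<bar>"
        using norm_triangle_ineq4[of "of_real a" "of_real b * j"] nj by (simp add: norm_mult)
      then have "norm x * norm (of_real a - of_real b * j) \<le> norm x * (\<bar>a\<bar> + \<bar>b\<bar>)"
        by (intro mult_left_mono) auto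
      moreover have "x * (of_real a - of_real b * j) = of_real a ^ 2 - of_real b ^ 2 * j\<^sup>2"
        by (simp add: ab power2_eq_square algebra_simps)
      then have "x * (of_real a - of_real b * j) = of_real (a\<^sup>2 + b\<^sup>2)" using 2(1) by simp
      then have "norm x * norm (of_real a - of_real b * j) = \<bar>a\<^sup>2 + b\<^sup>2\<bar>"
        by (metis norm_mult norm_of_real)
      then have "norm x * norm (of_real a - of_real b * j) = a\<^sup>2 + b\<^sup>2" by simp
      moreover have "(\<bar>a\<bar> + \<bar>b\<bar>)\<^sup>2 \<le> 2 * (a\<^sup>2 + b\<^sup>2)"
        using zero_le_power2[of "\<bar>a\<bar> - \<bar>b\<bar>"] by (simp add: power2_eq_square algebra_simps)
      ultimately have "(\<bar>a\<bar> + \<bar>b\<bar>) * (\<bar>a\<bar> + \<bar>b\<bar>) \<le> (2 * norm x) * (\<bar>a\<bar> + \<bar>b\<bar>)"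
        by (simp add: power2_eq_square)
      then have "\<bar>a\<bar> + \<bar>b\<bar> \<le> 2 * norm x"
        using mult_right_le_imp_le[of "\<bar>a\<bar> + \<bar>b\<bar>" "\<bar>a\<bar> + \<bar>b\<bar>" "2 * norm x"]
          norm_ge_zero[of x] by linarith
      moreover have "norm (a, b) \<le> \<bar>a\<bar> + \<bar>b\<bar>"
        using norm_Pair_le[of a b] by simp
      ultimately have "norm (a, b) \<le> 2 * r" using x by simp
      then show "x \<in> (\<lambda>w. of_real (fst w) + of_real (snd w) * j) ` cball (0 :: real \<times> real) (2 * r)"
        using ab by (intro image_eqI[of _ _ "(a, b)"]) auto
    qed
    then show thesis by (rule that[rotated]) (intro continuous_intros)
  qed
  then have "compact (g ` cball 0 R)"
    by (intro compact_continuous_image continuous_on_subset[OF g(1)]) auto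
  then have "compact (cball 0 r \<inter> g ` cball 0 R)" by (intro closed_Int_compact) auto
  then show ?thesis using g(2) by (simp add: Int_absorb2)
qed

section \<open>Normed spaces and spans\<close>

abbreviation vsub :: "('k::real_normed_field, 'a) nspace \<Rightarrow> 'a \<Rightarrow> 'a \<Rightarrow> 'a" where
  "vsub X x y \<equiv> vadd X x (vscale X (-1) y)"

section \<open>Vector arithmetic, closed subspaces and linear spans\<close>

context normed_space
begin

lemmas closed_simps [simp] = zero_closed add_closed scale_closed

lemma add_left_commute:
  "\<lbrakk>x \<in> carrier X; y \<in> carrier X; z \<in> carrier X\<rbrakk> \<Longrightarrow> vadd X x (vadd X y z) = vadd X y (vadd X x z)"
  by (metis add_assoc add_commute)

lemmas add_ac = add_assoc add_commute add_left_commute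

lemma zero_add [simp]: "x \<in> carrier X \<Longrightarrow> vadd X (vzero X) x = x"
  using add_zero add_commute zero_closed by metis

lemma inverse_add: "x \<in> carrier X \<Longrightarrow> vadd X (vscale X (-1) x) x = vzero X"
  by (simp add: add_commute[of "vscale X (-1) x" x] add_inverse)

lemma add_sub_cancel: "\<lbrakk>x \<in> carrier X; y \<in> carrier X\<rbrakk> \<Longrightarrow> vadd X x (vadd X (vscale X (-1) x) y) = y"
  by (metis add_assoc add_inverse zero_add scale_closed)

lemma sub_add_cancel: "\<lbrakk>x \<in> carrier X; y \<in> carrier X\<rbrakk> \<Longrightarrow> vadd X (vscale X (-1) x) (vadd X x y) = y"
  by (metis add_assoc inverse_add zero_add scale_closed)

lemma vsub_add: "\<lbrakk>x \<in> carrier X; y \<in> carrier X\<rbrakk> \<Longrightarrow> vadd X (vsub X x y) y = x"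
  by (simp add: add_assoc inverse_add add_zero)

lemma vsub_eq_zero: "\<lbrakk>x \<in> carrier X; y \<in> carrier X; vsub X x y = vzero X\<rbrakk> \<Longrightarrow> x = y"
  using vsub_add[of x y] by simp

lemma scale_zero_left: "x \<in> carrier X \<Longrightarrow> vscale X 0 x = vzero X"
  using scale_add_left[of x 1 "-1"] by (simp add: scale_one add_inverse)

lemma scale_zero_right: "vscale X c (vzero X) = vzero X"
  using scale_scale[of "vzero X" c 0] by (simp add: scale_zero_left)

lemma norm_zero: "vnorm X (vzero X) = 0"
  using norm_scale[of "vzero X" 0] by (simp add: scale_zero_left)

lemma norm_minus: "x \<in> carrier X \<Longrightarrow> vnorm X (vscale X (-1) x) = vnorm X x"
  by (simp add: norm_scale)

lemma norm_nonneg: "x \<in> carrier X \<Longrightarrow> 0 \<le> vnorm X x"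
  using norm_triangle[of x "vscale X (-1) x"] by (simp add: add_inverse norm_zero norm_minus)

lemma scale_diff_left:
  "x \<in> carrier X \<Longrightarrow> vscale X (c - d) x = vsub X (vscale X c x) (vscale X d x)"
  using scale_add_left[of x c "- d"] by (simp add: scale_scale)

lemma vsub_triangle:
  assumes "x \<in> carrier X" "y \<in> carrier X" "z \<in> carrier X"
  shows "vsub X x z = vadd X (vsub X x y) (vsub X y z)"
  using assms by (simp add: add_assoc sub_add_cancel)

lemma norm_vsub_triangle:
  assumes "x \<in> carrier X" "y \<in> carrier X" "z \<in> carrier X"
  shows "vnorm X (vsub X x z) \<le> vnorm X (vsub X x y) + vnorm X (vsub X y z)"
  using assms norm_triangle[of "vsub X x y" "vsub X y z"] by (simp flip: vsub_triangle)

lemma minus_vsub: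
  "\<lbrakk>x \<in> carrier X; y \<in> carrier X\<rbrakk> \<Longrightarrow> vscale X (-1) (vsub X x y) = vsub X y x"
  by (simp add: scale_add_right scale_scale scale_one add_commute)

lemma vsub_vsub_cancel:
  "\<lbrakk>x \<in> carrier X; y \<in> carrier X; z \<in> carrier X\<rbrakk> \<Longrightarrow> vsub X (vsub X x y) (vsub X x z) = vsub X z y"
  by (simp add: minus_vsub add_commute[of "vsub X x y"] flip: vsub_triangle)

lemma norm_vsub_commute:
  "\<lbrakk>x \<in> carrier X; y \<in> carrier X\<rbrakk> \<Longrightarrow> vnorm X (vsub X x y) = vnorm X (vsub X y x)"
  using norm_minus[of "vsub X x y"] minus_vsub[of x y] by simp

lemma Metric_space_vdist: "Metric_space (carrier X) (vdist X)"
proof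
  show "0 \<le> vdist X x y" for x y by (simp add: vdist_def norm_nonneg)
  show "vdist X x y = vdist X y x" for x y by (simp add: vdist_def norm_vsub_commute)
  show "vdist X x y = 0 \<longleftrightarrow> x = y" if "x \<in> carrier X" "y \<in> carrier X" for x y
  proof
    assume "vdist X x y = 0"
    then have "vnorm X (vsub X x y) = 0" using that by (simp add: vdist_def)
    then have "vsub X x y = vzero X" using that by (intro norm_eq_zero) auto
    then show "x = y" by (rule vsub_eq_zero[OF that])
  qed (use that in \<open>simp add: vdist_def add_inverse norm_zero\<close>)
  show "vdist X x z \<le> vdist X x y + vdist X y z"
    if "x \<in> carrier X" "y \<in> carrier X" "z \<in> carrier X" for x y z
    using that by (simp add: vdist_def norm_vsub_triangle)
qed

text \<open>A point off \<open>F\<close> has a ball that misses \<open>F\<close>, that is, a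
  positive distance from \<open>F\<close>. The closedness proofs below use this criterion in place
  of the topology.\<close>

lemma closed_subspace_iff:
  "closed_subspace F X \<longleftrightarrow> lin_subspace F X \<and>
    (\<forall>x\<in>carrier X - F. \<exists>d>0. \<forall>f\<in>F. d \<le> vnorm X (vsub X x f))"
proof -
  interpret M: Metric_space "carrier X" "vdist X" by (rule Metric_space_vdist)
  have "disjnt F (M.mball x r) \<longleftrightarrow> (\<forall>f\<in>F. r \<le> vnorm X (vsub X x f))"
    if "F \<subseteq> carrier X" "x \<in> carrier X" for x r
    using that by (fastforce simp: disjnt_iff vdist_def)
  then show ?thesis
    unfolding closed_subspace_def M.closedin_metric lin_subspace_def by auto
qed

lemma lin_subspace_carrier: "lin_subspace (carrier X) X"
  by (simp add: lin_subspace_def)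

lemma lin_subspace_zero: "lin_subspace {vzero X} X"
  by (simp add: lin_subspace_def add_zero scale_zero_right)

lemma lin_span_minimal: "\<lbrakk>lin_subspace F X; S \<subseteq> F\<rbrakk> \<Longrightarrow> lin_span X S \<subseteq> F"
  by (auto simp: lin_span_def)

lemma lin_span_superset: "S \<subseteq> lin_span X S"
  by (auto simp: lin_span_def)

lemma lin_subspace_span:
  assumes "S \<subseteq> carrier X"
  shows "lin_subspace (lin_span X S) X"
proof -
  have "lin_span X S \<subseteq> carrier X" by (rule lin_span_minimal[OF lin_subspace_carrier assms])
  then show ?thesis unfolding lin_subspace_def by (auto simp: lin_span_def lin_subspace_def)
qed

lemma lin_span_mono: "S \<subseteq> S' \<Longrightarrow> lin_span X S \<subseteq> lin_span X S'"
  by (auto simp: lin_span_def)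

lemma lin_span_empty: "lin_span X {} = {vzero X}"
  using lin_span_minimal[OF lin_subspace_zero] lin_subspace_span[of "{}"]
  by (auto simp: lin_subspace_def)

lemma lin_span_absorb:
  assumes "S \<subseteq> carrier X" "b \<in> lin_span X S"
  shows "lin_span X (insert b S) = lin_span X S"
proof
  show "lin_span X (insert b S) \<subseteq> lin_span X S"
    using assms lin_span_superset by (intro lin_span_minimal lin_subspace_span) auto
  show "lin_span X S \<subseteq> lin_span X (insert b S)" by (intro lin_span_mono) auto
qed

text \<open>\<open>has_dim_at_most\<close> asks for an independent spanning set, so vectors that lie
  in the span of the others are discarded one at a time.\<close>

lemma has_dim_at_most_span:
  "\<lbrakk>finite S; S \<subseteq> carrier X; card S \<le> n\<rbrakk> \<Longrightarrow> has_dim_at_most X (lin_span X S) n"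
proof (induction "card S" arbitrary: S)
  case 0
  then show ?case
    unfolding has_dim_at_most_def lin_basis_def by (auto intro!: exI[of _ "{}"])
next
  case (Suc k)
  show ?case
  proof (cases "\<forall>b\<in>S. b \<notin> lin_span X (S - {b})")
    case True
    then show ?thesis using Suc.prems lin_span_superset
      unfolding has_dim_at_most_def lin_basis_def by blast
  next
    case False
    then obtain b where b: "b \<in> S" "b \<in> lin_span X (S - {b})" by blast
    have "insert b (S - {b}) = S" using b by blast
    then have "lin_span X S = lin_span X (S - {b})"
      using lin_span_absorb[OF _ b(2)] Suc.prems by auto
    moreover have "has_dim_at_most X (lin_span X (S - {b})) n"
      using Suc b by (intro Suc.hyps) auto
    ultimately show ?thesis by simp
  qed
qed

lemma lin_span_insert:
  assumes "S \<subseteq> carrier X" "b \<in> carrier X"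
  shows "lin_span X (insert b S) = {vadd X f (vscale X c b) | f c. f \<in> lin_span X S}" (is "_ = ?E")
proof
  have F: "lin_subspace (lin_span X S) X" using assms(1) by (rule lin_subspace_span)
  then have Fc: "lin_span X S \<subseteq> carrier X" by (simp add: lin_subspace_def)
  have "lin_subspace ?E X"
    unfolding lin_subspace_def
  proof (intro conjI ballI allI)
    show "?E \<subseteq> carrier X" using Fc assms by auto
    have "vzero X = vadd X (vzero X) (vscale X 0 b)"
      using assms by (simp add: scale_zero_left)
    then show "vzero X \<in> ?E" using F unfolding lin_subspace_def by blast
  next
    fix x y assume "x \<in> ?E" "y \<in> ?E"
    then obtain f c g d where fg: "f \<in> lin_span X S" "g \<in> lin_span X S"
      and "x = vadd X f (vscale X c b)" "y = vadd X g (vscale X d b)" by blast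
    then have "vadd X x y = vadd X (vadd X f g) (vscale X (c + d) b)"
      using subsetD[OF Fc] assms by (simp add: scale_add_left add_ac)
    then show "vadd X x y \<in> ?E" using F fg unfolding lin_subspace_def by blast
  next
    fix a x assume "x \<in> ?E"
    then obtain f c where f: "f \<in> lin_span X S" and "x = vadd X f (vscale X c b)" by blast
    then have "vscale X a x = vadd X (vscale X a f) (vscale X (a * c) b)"
      using subsetD[OF Fc] assms by (simp add: scale_add_right scale_scale)
    then show "vscale X a x \<in> ?E" using F f unfolding lin_subspace_def by blast
  qed
  moreover have "insert b S \<subseteq> ?E"
  proof
    fix x assume x: "x \<in> insert b S"
    show "x \<in> ?E"
    proof (cases "x = b")
      case True
      then have "x = vadd X (vzero X) (vscale X 1 b)" using assms by (simp add: scale_one)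
      then show ?thesis using F unfolding lin_subspace_def by blast
    next
      case False
      then have "x \<in> S" using x by simp
      then have "x = vadd X x (vscale X 0 b)"
        using assms by (auto simp: scale_zero_left add_zero)
      then show ?thesis using \<open>x \<in> S\<close> lin_span_superset by blast
    qed
  qed
  ultimately show "lin_span X (insert b S) \<subseteq> ?E" by (rule lin_span_minimal)
  have G: "lin_subspace (lin_span X (insert b S)) X" using assms by (intro lin_subspace_span) auto
  show "?E \<subseteq> lin_span X (insert b S)"
  proof clarify
    fix f c assume "f \<in> lin_span X S"
    then have "f \<in> lin_span X (insert b S)" using lin_span_mono[of S "insert b S"] by auto
    moreover have "b \<in> lin_span X (insert b S)" using lin_span_superset by blast
    ultimately show "vadd X f (vscale X c b) \<in> lin_span X (insert b S)"
      using G unfolding lin_subspace_def by blast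
  qed
qed

text \<open>The distance \<open>\<phi> c\<close> of \<open>x - c * b\<close> from \<open>F\<close>
  is continuous in \<open>c\<close>, never zero, and at least 1 for large \<open>c\<close>.
  Compactness of the balls of scalars then bounds it away from zero.\<close>

lemma closed_subspace_add_line:
  assumes F: "closed_subspace F X" and b: "b \<in> carrier X - F"
    and x: "x \<in> carrier X" "\<And>f c. f \<in> F \<Longrightarrow> x \<noteq> vadd X f (vscale X c b)"
  obtains d where "0 < d" "\<And>f c. f \<in> F \<Longrightarrow> d \<le> vnorm X (vsub X x (vadd X f (vscale X c b)))"
proof -
  have sub: "lin_subspace F X"
    and sep: "\<And>y. y \<in> carrier X - F \<Longrightarrow> \<exists>d>0. \<forall>f\<in>F. d \<le> vnorm X (vsub X y f)"
    using F closed_subspace_iff by auto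
  have Fc [simp]: "f \<in> carrier X" if "f \<in> F" for f using sub that by (auto simp: lin_subspace_def)
  have zF: "vzero X \<in> F" and scF: "\<And>c f. f \<in> F \<Longrightarrow> vscale X c f \<in> F"
    using sub by (auto simp: lin_subspace_def)
  have [simp]: "b \<in> carrier X" using b by simp
  define \<delta> where "\<delta> y = (INF f\<in>F. vnorm X (vsub X y f))" for y
  have bdd: "bdd_below ((\<lambda>f. vnorm X (vsub X y f)) ` F)" if "y \<in> carrier X" for y
    using that by (intro bdd_belowI2[of _ 0]) (simp add: norm_nonneg)
  have \<delta>_le: "\<delta> y \<le> vnorm X (vsub X y f)" if "y \<in> carrier X" "f \<in> F" for y f
    unfolding \<delta>_def using bdd[OF that(1)] that(2) by (rule cINF_lower)
  have \<delta>_ge: "e \<le> \<delta> y" if "\<And>f. f \<in> F \<Longrightarrow> e \<le> vnorm X (vsub X y f)" for e y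
    unfolding \<delta>_def using zF that by (intro cINF_greatest) auto
  have \<delta>_lip: "\<delta> y \<le> \<delta> z + vnorm X (vsub X y z)" if "y \<in> carrier X" "z \<in> carrier X" for y z
  proof -
    have "\<delta> y - vnorm X (vsub X y z) \<le> \<delta> z"
    proof (rule \<delta>_ge)
      fix f assume "f \<in> F"
      then show "\<delta> y - vnorm X (vsub X y z) \<le> vnorm X (vsub X z f)"
        using \<delta>_le[of y f] norm_vsub_triangle[of y z f] that by simp
    qed
    then show ?thesis by simp
  qed
  \<comment> \<open>Rescaling an element of \<open>F\<close> by \<open>inverse c\<close> stays in
    \<open>F\<close>, so distances from \<open>F\<close> scale with the vector.\<close>
  have \<delta>_scale: "norm c * \<delta> b \<le> \<delta> (vscale X c b)" for c
  proof (rule \<delta>_ge)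
    fix f assume f: "f \<in> F"
    show "norm c * \<delta> b \<le> vnorm X (vsub X (vscale X c b) f)"
    proof (cases "c = 0")
      case False
      have "vsub X (vscale X c b) f = vscale X c (vsub X b (vscale X (inverse c) f))"
        using f False by (simp add: scale_add_right scale_scale)
      then have "vnorm X (vsub X (vscale X c b) f) = norm c * vnorm X (vsub X b (vscale X (inverse c) f))"
        using f by (simp add: norm_scale)
      then show ?thesis using \<delta>_le[of b "vscale X (inverse c) f"] scF f by (simp add: mult_left_mono)
    qed (use f in \<open>simp add: norm_nonneg\<close>)
  qed
  obtain e where e: "0 < e" "\<forall>f\<in>F. e \<le> vnorm X (vsub X b f)" using sep b by blast
  have "0 < \<delta> b" using \<delta>_ge[of e b] e by fastforce
  define \<phi> where "\<phi> c = \<delta> (vsub X x (vscale X c b))" for c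
  have lip: "\<phi> c - \<phi> c' \<le> vnorm X b * norm (c - c')" for c c'
  proof -
    have "vsub X (vsub X x (vscale X c b)) (vsub X x (vscale X c' b)) = vscale X (c' - c) b"
      using x(1) by (simp add: vsub_vsub_cancel scale_diff_left)
    then show ?thesis
      using \<delta>_lip[of "vsub X x (vscale X c b)" "vsub X x (vscale X c' b)"] x(1)
      by (simp add: \<phi>_def norm_scale norm_minus_commute mult.commute)
  qed
  have "dist (\<phi> c) (\<phi> c') \<le> vnorm X b * dist c c'" for c c'
    using lip[of c c'] lip[of c' c] norm_minus_commute[of c' c]
    by (simp add: dist_norm abs_le_iff)
  then have cont: "continuous_on S \<phi>" for S
    by (intro lipschitz_on_continuous_on[of "vnorm X b"]) (auto simp: lipschitz_on_def norm_nonneg)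
  \<comment> \<open>Chosen so that \<open>norm c > r\<close> forces
    \<open>norm c * \<delta> b \<ge> vnorm X x + 1\<close>, and therefore
    \<open>\<phi> c \<ge> 1\<close>.\<close>
  define r where "r = (vnorm X x + 1) / \<delta> b"
  have "0 \<le> r" using \<open>0 < \<delta> b\<close> norm_nonneg[OF x(1)] by (simp add: r_def)
  then obtain c0 where c0: "\<And>c. c \<in> cball 0 r \<Longrightarrow> \<phi> c0 \<le> \<phi> c"
    using continuous_attains_inf[OF compact_cball_field _ cont, of r] by (metis cball_eq_empty not_le)
  \<comment> \<open>Otherwise \<open>x\<close> would be the sum of an element of \<open>F\<close>
    and \<open>c0 * b\<close>. Hence the minimum \<open>\<phi> c0\<close> is positive.\<close>
  have "vsub X x (vscale X c0 b) \<notin> F"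
    using x(2)[of "vsub X x (vscale X c0 b)" c0] x(1) by (auto simp: vsub_add)
  then obtain d0 where d0: "0 < d0" "\<forall>f\<in>F. d0 \<le> vnorm X (vsub X (vsub X x (vscale X c0 b)) f)"
    using sep[of "vsub X x (vscale X c0 b)"] x(1) by auto
  then have "0 < \<phi> c0" unfolding \<phi>_def using \<delta>_ge[of d0] by fastforce
  have "min 1 (\<phi> c0) \<le> vnorm X (vsub X x (vadd X f (vscale X c b)))" if f: "f \<in> F" for f c
  proof -
    have "min 1 (\<phi> c0) \<le> \<phi> c"
    proof (cases "norm c \<le> r")
      case True
      then show ?thesis using c0[of c] by simp
    next
      case False
      have "vnorm X x + 1 \<le> norm c * \<delta> b"
        using False \<open>0 < \<delta> b\<close> by (simp add: r_def field_simps)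
      also have "\<dots> \<le> \<delta> (vscale X (- c) b)" using \<delta>_scale[of "- c"] by simp
      also have "\<dots> \<le> \<phi> c + vnorm X (vsub X (vscale X (- c) b) (vsub X x (vscale X c b)))"
        unfolding \<phi>_def using x(1) by (intro \<delta>_lip) auto
      also have "vsub X (vscale X (- c) b) (vsub X x (vscale X c b)) = vscale X (-1) x"
        using x(1) sub_add_cancel[of "vscale X c b" "vscale X (-1) x"]
          minus_vsub[of x "vscale X c b"] scale_scale[of b "-1" c] by simp
      finally show ?thesis using x(1) by (simp add: norm_minus)
    qed
    also have "\<phi> c \<le> vnorm X (vsub X (vsub X x (vscale X c b)) f)"
      unfolding \<phi>_def using x(1) f by (intro \<delta>_le) auto
    also have "vsub X (vsub X x (vscale X c b)) f = vsub X x (vadd X f (vscale X c b))"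
      using x(1) f by (simp add: scale_add_right scale_scale add_ac)
    finally show ?thesis .
  qed
  then show thesis using that[of "min 1 (\<phi> c0)"] \<open>0 < \<phi> c0\<close> by simp
qed

text \<open>Induction on the generators: a new one is either redundant or adds a line to a closed
  subspace.\<close>

lemma closed_subspace_span:
  "\<lbrakk>finite S; S \<subseteq> carrier X\<rbrakk> \<Longrightarrow> closed_subspace (lin_span X S) X"
proof (induction S rule: finite_induct)
  case empty
  have "\<exists>d>0. d \<le> vnorm X (vsub X x (vzero X))" if "x \<in> carrier X - {vzero X}" for x
  proof -
    have "vnorm X x \<noteq> 0" using that norm_eq_zero[of x] by blast
    then have "0 < vnorm X x" using norm_nonneg[of x] that by simp
    then show ?thesis using that by (auto simp: scale_zero_right add_zero)
  qed
  then show ?case by (simp add: lin_span_empty closed_subspace_iff lin_subspace_zero)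
next
  case (insert b S)
  then have F: "closed_subspace (lin_span X S) X" and S: "S \<subseteq> carrier X" "b \<in> carrier X" by auto
  show ?case
  proof (cases "b \<in> lin_span X S")
    case True
    then show ?thesis using F lin_span_absorb[OF S(1)] by simp
  next
    case False
    show ?thesis
      unfolding closed_subspace_iff
    proof (intro conjI ballI)
      show "lin_subspace (lin_span X (insert b S)) X" using insert by (intro lin_subspace_span)
      fix x assume "x \<in> carrier X - lin_span X (insert b S)"
      then have x: "x \<in> carrier X"
        "\<And>f c. f \<in> lin_span X S \<Longrightarrow> x \<noteq> vadd X f (vscale X c b)"
        unfolding lin_span_insert[OF S] by auto
      from False S have "b \<in> carrier X - lin_span X S" by simp
      from closed_subspace_add_line[OF F this x] obtain d where "0 < d"
        "\<And>f c. f \<in> lin_span X S \<Longrightarrow> d \<le> vnorm X (vsub X x (vadd X f (vscale X c b)))"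
        by blast
      then show "\<exists>d>0. \<forall>f\<in>lin_span X (insert b S). d \<le> vnorm X (vsub X x f)"
        unfolding lin_span_insert[OF S] by blast
    qed
  qed
qed

end

section \<open>The Hahn-Banach theorem\<close>

context normed_space
begin

text \<open>Domination by the norm is part of the notion, which bounds all these functionals from
  below as well and keeps the infima finite. The value 0 outside the carrier lets functionals be
  compared as functions on the whole type, as minimality requires.\<close>

definition sublinear :: "('a \<Rightarrow> real) \<Rightarrow> bool" where
  "sublinear p \<longleftrightarrow> (\<forall>x. x \<notin> carrier X \<longrightarrow> p x = 0) \<and> (\<forall>x\<in>carrier X. p x \<le> vnorm X x) \<and>
    (\<forall>x\<in>carrier X. \<forall>y\<in>carrier X. p (vadd X x y) \<le> p x + p y) \<and>
    (\<forall>t>0. \<forall>x\<in>carrier X. p (vscale X (of_real t) x) \<le> t * p x)"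

lemma sublinear_zero: "sublinear p \<Longrightarrow> p (vzero X) = 0"
  unfolding sublinear_def using norm_zero zero_closed add_zero
  by (metis add_le_same_cancel1 antisym le_add_same_cancel2 zero_add)

lemma sublinear_ge:
  assumes "sublinear p" "x \<in> carrier X"
  shows "- vnorm X x \<le> p x"
proof -
  have "0 = p (vsub X x x)" using assms by (simp add: add_inverse sublinear_zero)
  also have "\<dots> \<le> p x + p (vscale X (-1) x)" using assms by (simp add: sublinear_def)
  also have "p (vscale X (-1) x) \<le> vnorm X (vscale X (-1) x)"
    using assms unfolding sublinear_def by simp
  finally show ?thesis using assms by (simp add: norm_minus)
qed

text \<open>The reverse inequality is the defining one for \<open>1 / r\<close>, applied to the
  scaled vector.\<close>

lemma sublinear_scale:
  assumes p: "sublinear p" and x: "x \<in> carrier X" and r: "0 < r"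
  shows "p (vscale X (of_real r) x) = r * p x"
proof (rule antisym)
  have *: "p (vscale X (of_real s) z) \<le> s * p z" if "0 < s" "z \<in> carrier X" for s z
    using p that by (simp add: sublinear_def)
  then show "p (vscale X (of_real r) x) \<le> r * p x" using x r by simp
  have "p (vscale X (of_real (1 / r)) (vscale X (of_real r) x)) \<le> (1 / r) * p (vscale X (of_real r) x)"
    using x r by (intro *) auto
  then show "r * p x \<le> p (vscale X (of_real r) x)"
    using x r by (simp add: scale_scale scale_one field_simps)
qed

text \<open>The classical auxiliary functional of the Hahn-Banach proof. For sublinear
  \<open>p\<close> it lies below \<open>p\<close> (take \<open>t = 0\<close>), and its value at
  \<open>- y\<close> is at most \<open>- p y\<close> (take \<open>t = 1\<close>).\<close>

definition shift :: "('a \<Rightarrow> real) \<Rightarrow> 'a \<Rightarrow> 'a \<Rightarrow> real" where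
  "shift p y x =
    (if x \<in> carrier X then INF t\<in>{0..}. p (vadd X x (vscale X (of_real t) y)) - t * p y else 0)"

text \<open>The infimum is finite: \<open>s * p y = p (s * y) \<le> p (x + s * y) + p (- x)\<close>
  bounds every term below by \<open>- vnorm X x\<close>.\<close>

lemma shift_le:
  assumes p: "sublinear p" and y: "y \<in> carrier X" and x: "x \<in> carrier X" and "0 \<le> t"
  shows "shift p y x \<le> p (vadd X x (vscale X (of_real t) y)) - t * p y"
proof -
  have "- vnorm X x \<le> p (vadd X x (vscale X (of_real s) y)) - s * p y" if "0 \<le> s" for s
  proof -
    let ?sy = "vscale X (of_real s) y"
    have "p ?sy = s * p y"
      using p y that by (cases "s = 0") (auto simp: scale_zero_left sublinear_zero sublinear_scale)
    moreover have "?sy = vadd X (vadd X x ?sy) (vscale X (-1) x)"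
      using x y by (simp add: add_assoc add_commute[of ?sy] add_sub_cancel)
    then have "p ?sy \<le> p (vadd X x ?sy) + p (vscale X (-1) x)"
      using p x y unfolding sublinear_def by (metis add_closed scale_closed)
    moreover have "p (vscale X (-1) x) \<le> vnorm X (vscale X (-1) x)"
      using p x by (simp add: sublinear_def del: add_le_cancel_left)
    ultimately show ?thesis using norm_minus[OF x] by linarith
  qed
  then have "bdd_below ((\<lambda>t. p (vadd X x (vscale X (of_real t) y)) - t * p y) ` {0..})"
    by (intro bdd_belowI2) auto
  from cINF_lower[OF this, of t] show ?thesis using x \<open>0 \<le> t\<close> by (simp add: shift_def)
qed

lemma shift_ge:
  assumes "x \<in> carrier X" "\<And>t. 0 \<le> t \<Longrightarrow> e \<le> p (vadd X x (vscale X (of_real t) y)) - t * p y"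
  shows "e \<le> shift p y x"
  using assms unfolding shift_def by (auto intro!: cINF_greatest)

lemma shift_le_self:
  "\<lbrakk>sublinear p; y \<in> carrier X\<rbrakk> \<Longrightarrow> shift p y x \<le> p x"
  using shift_le[of p y x 0]
  by (cases "x \<in> carrier X") (auto simp: scale_zero_left add_zero shift_def sublinear_def)

text \<open>For subadditivity the parameters \<open>t\<close> and \<open>t'\<close> of the two
  summands are merged into \<open>t + t'\<close>; for homogeneity \<open>t\<close> is replaced by
  \<open>s * t\<close>.\<close>

lemma sublinear_shift:
  assumes p: "sublinear p" and y: "y \<in> carrier X"
  shows "sublinear (shift p y)"
  unfolding sublinear_def
proof (intro conjI ballI allI impI)
  show "shift p y x = 0" if "x \<notin> carrier X" for x using that by (simp add: shift_def)
  show "shift p y x \<le> vnorm X x" if "x \<in> carrier X" for x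
    using shift_le_self[OF p y, of x] p that unfolding sublinear_def by force
next
  fix x x' assume x: "x \<in> carrier X" "x' \<in> carrier X"
  let ?v = "\<lambda>x t. p (vadd X x (vscale X (of_real t) y)) - t * p y"
  have *: "shift p y (vadd X x x') \<le> ?v x t + ?v x' t'" if "0 \<le> t" "0 \<le> t'" for t t'
  proof -
    have eq: "vadd X (vadd X x x') (vscale X (of_real (t + t')) y) =
        vadd X (vadd X x (vscale X (of_real t) y)) (vadd X x' (vscale X (of_real t') y))"
      using x y by (simp add: scale_add_left add_ac)
    have "shift p y (vadd X x x') \<le> ?v (vadd X x x') (t + t')"
      using p x y that by (intro shift_le) auto
    moreover have "p (vadd X (vadd X x x') (vscale X (of_real (t + t')) y)) \<le>
        p (vadd X x (vscale X (of_real t) y)) + p (vadd X x' (vscale X (of_real t') y))"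
      unfolding eq using p x y unfolding sublinear_def by simp
    ultimately show ?thesis by (simp add: algebra_simps)
  qed
  have "shift p y (vadd X x x') - ?v x' t' \<le> shift p y x" if "0 \<le> t'" for t'
    using *[OF _ that] by (intro shift_ge x(1)) (simp add: algebra_simps)
  then have "shift p y (vadd X x x') - shift p y x \<le> shift p y x'"
    by (intro shift_ge x(2)) (simp add: algebra_simps)
  then show "shift p y (vadd X x x') \<le> shift p y x + shift p y x'" by simp
next
  fix s :: real and x assume s: "0 < s" and x: "x \<in> carrier X"
  have "shift p y (vscale X (of_real s) x) / s \<le> shift p y x"
  proof (rule shift_ge[OF x])
    fix t :: real assume t: "0 \<le> t"
    let ?z = "vadd X x (vscale X (of_real t) y)"
    have eq: "vadd X (vscale X (of_real s) x) (vscale X (of_real (s * t)) y) = vscale X (of_real s) ?z"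
      using x y by (simp add: scale_add_right scale_scale)
    have "shift p y (vscale X (of_real s) x) \<le> p (vscale X (of_real s) ?z) - (s * t) * p y"
      unfolding eq[symmetric] using p x y s t by (intro shift_le) auto
    also have "p (vscale X (of_real s) ?z) \<le> s * p ?z"
      using p x y s unfolding sublinear_def by simp
    finally show "shift p y (vscale X (of_real s) x) / s \<le> p ?z - t * p y"
      using s by (simp add: field_simps)
  qed
  then show "shift p y (vscale X (of_real s) x) \<le> s * shift p y x"
    using s by (simp add: field_simps)
qed

text \<open>A minimal sublinear functional is fixed by all shifts, which makes it additive.\<close>

lemma exists_minimal_sublinear:
  assumes p0: "sublinear p0"
  obtains p where "sublinear p" "p \<le> p0" "\<And>q. \<lbrakk>sublinear q; q \<le> p\<rbrakk> \<Longrightarrow> q = p"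
proof -
  define A where "A = {p. sublinear p \<and> p \<le> p0}"
  have "\<exists>m\<in>A. \<forall>a\<in>A. a \<le> m \<longrightarrow> a = m"
  proof (rule predicate_Zorn)
    show "partial_order_on A (relation_of (\<lambda>x y. y \<le> x) A)"
      by (rule partial_order_on_relation_ofI) auto
    fix C assume C: "C \<in> Chains (relation_of (\<lambda>x y. y \<le> x) A)"
    then have CA: "C \<subseteq> A" and tot: "\<And>p q. \<lbrakk>p \<in> C; q \<in> C\<rbrakk> \<Longrightarrow> p \<le> q \<or> q \<le> p"
      unfolding Chains_def relation_of_def by auto
    show "\<exists>u\<in>A. \<forall>a\<in>C. u \<le> a"
    proof (cases "C = {}")
      case True
      then show ?thesis using p0 by (auto simp: A_def)
    next
      case False
      have sl: "sublinear p" "p \<le> p0" if "p \<in> C" for p using that CA by (auto simp: A_def)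
      \<comment> \<open>The order is reversed, so Zorn's lemma asks for a lower bound of the chain.
        This is the pointwise infimum, finite because all members are at least
        \<open>- vnorm X x\<close> at \<open>x\<close>.\<close>
      define u where "u x = (if x \<in> carrier X then INF p\<in>C. p x else 0)" for x
      have le: "u x \<le> p x" if "p \<in> C" for p x
      proof (cases "x \<in> carrier X")
        case True
        then have "bdd_below ((\<lambda>p. p x) ` C)"
          using sl sublinear_ge by (intro bdd_belowI2) blast
        from cINF_lower[OF this that] show ?thesis using True by (simp add: u_def)
      qed (use sl[OF that] in \<open>simp add: u_def sublinear_def\<close>)
      have ge: "e \<le> u x" if "x \<in> carrier X" "\<And>p. p \<in> C \<Longrightarrow> e \<le> p x" for e x
        using that False by (auto simp: u_def intro!: cINF_greatest)
      have "sublinear u"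
        unfolding sublinear_def
      proof (intro conjI ballI allI impI)
        show "u x = 0" if "x \<notin> carrier X" for x using that by (simp add: u_def)
        show "u x \<le> vnorm X x" if "x \<in> carrier X" for x
        proof -
          obtain p where p: "p \<in> C" using False by blast
          have "p x \<le> vnorm X x" using sl(1)[OF p] that by (simp add: sublinear_def)
          with le[OF p, of x] show ?thesis by linarith
        qed
      next
        fix x y assume x: "x \<in> carrier X" "y \<in> carrier X"
        have *: "u (vadd X x y) \<le> p x + q y" if pq: "p \<in> C" "q \<in> C" for p q
        proof -
          \<comment> \<open>Comparability gives a member below both \<open>p\<close> and
            \<open>q\<close>, and its subadditivity serves for the mixed sum.\<close>
          obtain r where r: "r \<in> C" "r \<le> p" "r \<le> q" using tot[OF pq] pq by blast
          have "r (vadd X x y) \<le> r x + r y" using sl(1)[OF r(1)] x by (simp add: sublinear_def)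
          with le[OF r(1), of "vadd X x y"] le_funD[OF r(2), of x] le_funD[OF r(3), of y]
          show ?thesis by linarith
        qed
        have "u (vadd X x y) - q y \<le> u x" if "q \<in> C" for q
          using *[OF _ that] by (intro ge x(1)) (simp add: algebra_simps)
        then have "u (vadd X x y) - u x \<le> u y"
          by (intro ge x(2)) (simp add: algebra_simps)
        then show "u (vadd X x y) \<le> u x + u y" by simp
      next
        fix s :: real and x assume s: "0 < s" and x: "x \<in> carrier X"
        have "u (vscale X (of_real s) x) / s \<le> u x"
        proof (rule ge[OF x])
          fix p assume p: "p \<in> C"
          have "p (vscale X (of_real s) x) \<le> s * p x" using sl(1)[OF p] x s by (simp add: sublinear_def)
          with le[OF p, of "vscale X (of_real s) x"] have "u (vscale X (of_real s) x) \<le> s * p x" by linarith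
          then show "u (vscale X (of_real s) x) / s \<le> p x" using s by (simp add: field_simps)
        qed
        then show "u (vscale X (of_real s) x) \<le> s * u x" using s by (simp add: field_simps)
      qed
      moreover have "u \<le> p0"
      proof -
        obtain p where p: "p \<in> C" using False by blast
        have "u \<le> p" using le[OF p] by (rule le_funI)
        then show ?thesis using sl(2)[OF p] by (rule order_trans)
      qed
      ultimately have "u \<in> A" by (simp add: A_def)
      then show ?thesis using le by (auto intro: le_funI)
    qed
  qed
  then obtain p where p: "p \<in> A" "\<forall>a\<in>A. a \<le> p \<longrightarrow> a = p" by blast
  show thesis
  proof (rule that)
    show "sublinear p" "p \<le> p0" using p by (auto simp: A_def)
    show "q = p" if "sublinear q" "q \<le> p" for q
      using p that by (auto simp: A_def intro: order_trans)
  qed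
qed

text \<open>Minimality is sought below \<open>shift \<nu> y\<close> and not merely below the norm.
  This forces \<open>u (- y) \<le> - vnorm X y\<close>, so that \<open>u\<close> attains the norm at
  \<open>y\<close>.\<close>

lemma real_linear_norming:
  assumes y: "y \<in> carrier X"
  obtains u where "\<And>x x'. \<lbrakk>x \<in> carrier X; x' \<in> carrier X\<rbrakk> \<Longrightarrow> u (vadd X x x') = u x + u x'"
    "\<And>r x. x \<in> carrier X \<Longrightarrow> u (vscale X (of_real r) x) = r * u x"
    "\<And>x. x \<in> carrier X \<Longrightarrow> u x \<le> vnorm X x" "u y = vnorm X y"
proof -
  define \<nu> where "\<nu> x = (if x \<in> carrier X then vnorm X x else 0)" for x
  have \<nu>: "sublinear \<nu>"
    unfolding sublinear_def \<nu>_def by (auto simp: norm_triangle norm_scale)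
  obtain u where u: "sublinear u" "u \<le> shift \<nu> y" "\<And>q. \<lbrakk>sublinear q; q \<le> u\<rbrakk> \<Longrightarrow> q = u"
    using exists_minimal_sublinear[OF sublinear_shift[OF \<nu> y]] by blast
  have fixed: "shift u z = u" if "z \<in> carrier X" for z
    using u(3)[OF sublinear_shift[OF u(1) that]] shift_le_self[OF u(1) that] by (simp add: le_fun_def)
  have add: "u (vadd X x x') = u x + u x'" if x: "x \<in> carrier X" "x' \<in> carrier X" for x x'
  proof (rule antisym)
    show "u (vadd X x x') \<le> u x + u x'" using u(1) x by (simp add: sublinear_def)
    \<comment> \<open>As \<open>u\<close> is its own shift along \<open>x'\<close>, the parameter 1
      gives \<open>u x \<le> u (x + x') - u x'\<close>.\<close>
    show "u x + u x' \<le> u (vadd X x x')"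
      using shift_le[OF u(1) x(2) x(1), of 1] x by (simp add: fixed scale_one)
  qed
  have pos: "u (vscale X (of_real r) x) = r * u x" if "0 < r" "x \<in> carrier X" for r x
    using sublinear_scale[OF u(1)] that by blast
  have minus: "u (vscale X (-1) x) = - u x" if "x \<in> carrier X" for x
    using add[of x "vscale X (-1) x"] that by (simp add: add_inverse sublinear_zero[OF u(1)])
  have scale: "u (vscale X (of_real r) x) = r * u x" if x: "x \<in> carrier X" for r x
  proof -
    consider "0 < r" | "r = 0" | "r < 0" by linarith
    then show ?thesis
    proof cases
      case 3
      then have "u (vscale X (of_real (- r)) x) = - r * u x" using pos[of "- r" x] x by simp
      moreover have "vscale X (of_real r) x = vscale X (-1) (vscale X (of_real (- r)) x)"
        using x by (simp add: scale_scale)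
      ultimately show ?thesis using minus[of "vscale X (of_real (- r)) x"] x by simp
    qed (use pos x u(1) in \<open>auto simp: scale_zero_left sublinear_zero\<close>)
  qed
  have "u (vscale X (-1) y) \<le> shift \<nu> y (vscale X (-1) y)" using u(2) by (rule le_funD)
  also have "\<dots> \<le> \<nu> (vadd X (vscale X (-1) y) (vscale X (of_real 1) y)) - 1 * \<nu> y"
    using y by (intro shift_le \<nu>) auto
  also have "\<dots> = - vnorm X y" using y by (simp add: \<nu>_def scale_one inverse_add norm_zero)
  finally have "vnorm X y \<le> u y" using minus[OF y] by simp
  moreover have le: "u x \<le> vnorm X x" if "x \<in> carrier X" for x
    using u(1) that by (simp add: sublinear_def)
  ultimately show thesis using that[of u] add scale y by (meson antisym)
qed

end

section \<open>Passage from real to complex functionals\<close>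

lemma real_part_le_norm:
  fixes j :: "'k::real_normed_field"
  assumes j: "j\<^sup>2 = -1"
  shows "\<bar>a\<bar> \<le> norm (of_real a + of_real b * j)"
proof -
  \<comment> \<open>A ring embedding of the complex numbers. It turns out to be isometric, so the
    absolute value of the real part is at most the norm.\<close>
  define h where "h z = of_real (Re z) + of_real (Im z) * j" for z
  have mult: "h (z * w) = h z * h w" for z w
  proof -
    have "h z * h w = of_real (Re z * Re w) + of_real (Im z * Im w) * j\<^sup>2 +
        of_real (Re z * Im w + Im z * Re w) * j"
      by (simp add: h_def power2_eq_square algebra_simps)
    then show ?thesis by (simp add: h_def j algebra_simps)
  qed
  have pow: "h (z ^ n) = h z ^ n" for z n
    by (induction n) (simp_all add: mult, simp add: h_def)
  have "norm j ^ 2 = 1 ^ 2" using j by (simp flip: norm_power)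
  then have nj: "norm j = 1" by (rule power2_eq_imp_eq) auto
  have two: "norm (h z) \<le> 2 * cmod z" for z
    using norm_triangle_ineq[of "of_real (Re z)" "of_real (Im z) * j"] abs_Re_le_cmod[of z]
      abs_Im_le_cmod[of z] by (simp add: h_def norm_mult nj)
  text \<open>The factor 2 disappears when the estimate is applied to the powers of \<open>z\<close>.\<close>
  have one: "norm (h z) \<le> cmod z" for z
  proof (cases "z = 0")
    case True
    then show ?thesis by (simp add: h_def)
  next
    case False
    show ?thesis
    proof (rule ccontr)
      assume "\<not> norm (h z) \<le> cmod z"
      then have "1 < norm (h z) / cmod z" using False by simp
      then obtain n where "2 < (norm (h z) / cmod z) ^ n" using real_arch_pow by blast
      moreover have "norm (h z) ^ n \<le> 2 * cmod z ^ n"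
        using two[of "z ^ n"] by (simp add: pow norm_power)
      ultimately show False using False by (simp add: power_divide field_simps)
    qed
  qed
  \<comment> \<open>The opposite estimate comes from the conjugate: \<open>(cmod z)^2 = norm (h z) *
    norm (h (cnj z)) \<le> norm (h z) * cmod z\<close>.\<close>
  define z where "z = Complex a b"
  have "h (z * cnj z) = of_real (a\<^sup>2 + b\<^sup>2)" by (simp add: h_def z_def power2_eq_square)
  then have "norm (h z) * norm (h (cnj z)) = (cmod z)\<^sup>2"
    unfolding mult by (metis (no_types) norm_mult norm_of_real abs_of_nonneg cmod_power2 complex.sel
        sum_power2_ge_zero z_def)
  moreover have "norm (h z) * norm (h (cnj z)) \<le> norm (h z) * cmod z"
    using one[of "cnj z"] by (simp add: mult_left_mono)
  ultimately have "cmod z * cmod z \<le> norm (h z) * cmod z" by (simp add: power2_eq_square)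
  then have "cmod z \<le> norm (h z)"
    using mult_right_le_imp_le[of "cmod z" "cmod z" "norm (h z)"] by (cases "z = 0") auto
  then show ?thesis using abs_Re_le_cmod[of z] by (simp add: h_def z_def)
qed

text \<open>A real-linear functional \<open>u\<close> that attains the norm at \<open>y\<close> is
  made linear over the scalars. Its bound is recovered by rotating \<open>f x\<close> to a
  nonnegative real number.\<close>

theorem (in normed_space) norming_functional:
  assumes y: "y \<in> carrier X"
  obtains f :: "'a \<Rightarrow> 'k" where "\<And>x x'. \<lbrakk>x \<in> carrier X; x' \<in> carrier X\<rbrakk> \<Longrightarrow> f (vadd X x x') = f x + f x'"
    "\<And>c x. x \<in> carrier X \<Longrightarrow> f (vscale X c x) = c * f x"
    "\<And>x. x \<in> carrier X \<Longrightarrow> norm (f x) \<le> vnorm X x" "vnorm X y \<le> norm (f y)"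
proof -
  obtain u where u: "\<And>x x'. \<lbrakk>x \<in> carrier X; x' \<in> carrier X\<rbrakk> \<Longrightarrow> u (vadd X x x') = u x + u x'"
    "\<And>r x. x \<in> carrier X \<Longrightarrow> u (vscale X (of_real r) x) = r * u x"
    "\<And>x. x \<in> carrier X \<Longrightarrow> u x \<le> vnorm X x" "u y = vnorm X y"
    using real_linear_norming[OF y] by blast
  \<comment> \<open>The last clause says that \<open>f\<close> agrees with \<open>u\<close> wherever
    \<open>f\<close> takes real values. The norm estimate uses only this, so both scalar fields can
    be finished together.\<close>
  have "\<exists>f :: 'a \<Rightarrow> 'k. (\<forall>x\<in>carrier X. \<forall>x'\<in>carrier X. f (vadd X x x') = f x + f x') \<and>
      (\<forall>c. \<forall>x\<in>carrier X. f (vscale X c x) = c * f x) \<and> vnorm X y \<le> norm (f y) \<and>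
      (\<forall>x\<in>carrier X. \<forall>r. f x = of_real r \<longrightarrow> r = u x)"
    using real_or_complex_field[where 'k = 'k]
  proof (elim disjE exE conjE)
    assume real: "\<forall>c::'k. c \<in> range of_real"
    have "of_real (u (vscale X c x)) = c * of_real (u x)" if "x \<in> carrier X" for c x
    proof -
      obtain r where "c = of_real r" using real by blast
      then show ?thesis using u(2)[OF that] by simp
    qed
    then show ?thesis using u by (intro exI[of _ "\<lambda>x. of_real (u x)"]) auto
  next
    fix j :: 'k
    assume j: "j\<^sup>2 = -1" and rep: "\<forall>c. \<exists>a b. c = of_real a + of_real b * j"
    have jj: "j * j = -1" using j by (simp add: power2_eq_square)
    \<comment> \<open>The real part is to be \<open>u\<close>; the coefficient of \<open>j\<close>
      is then forced by \<open>f (j * x) = j * f x\<close>.\<close>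
    define f where "f x = of_real (u x) - of_real (u (vscale X j x)) * j" for x
    have "f (vadd X x x') = f x + f x'" if "x \<in> carrier X" "x' \<in> carrier X" for x x'
      using that by (simp add: f_def u scale_add_right algebra_simps)
    moreover have "f (vscale X c x) = c * f x" if x: "x \<in> carrier X" for c x
    proof -
      obtain a b where c: "c = of_real a + of_real b * j" using rep by blast
      let ?jx = "vscale X j x"
      have "vscale X c x = vadd X (vscale X (of_real a) x) (vscale X (of_real b) ?jx)"
        using x by (simp add: c scale_add_left scale_scale)
      then have 1: "u (vscale X c x) = a * u x + b * u ?jx" using x by (simp add: u)
      have "j * c = of_real a * j + of_real b * (j * j)" by (simp add: c algebra_simps)
      then have "j * c = of_real a * j + of_real (- b)" unfolding jj by simp
      then have "vscale X j (vscale X c x) = vadd X (vscale X (of_real a) ?jx) (vscale X (of_real (- b)) x)"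
        using x by (simp only: scale_scale scale_add_left)
      then have 2: "u (vscale X j (vscale X c x)) = a * u ?jx + (- b) * u x"
        using x by (simp only: u scale_closed)
      have "c * f x = of_real a * of_real (u x) - of_real b * of_real (u ?jx) * (j * j)
          - (of_real a * of_real (u ?jx) - of_real b * of_real (u x)) * j"
        by (simp add: c f_def algebra_simps)
      then show ?thesis unfolding jj by (simp add: f_def 1 2)
    qed
    moreover have "vnorm X y \<le> norm (f y)"
      using real_part_le_norm[OF j, of "u y" "- u (vscale X j y)"] u(4) by (simp add: f_def)
    moreover have "r = u x" if "f x = of_real r" for x r
      using real_part_le_norm[OF j, of "u x - r" "- u (vscale X j x)"] that by (simp add: f_def algebra_simps)
    ultimately show ?thesis by blast
  qed
  then obtain f :: "'a \<Rightarrow> 'k" where f: "\<forall>x\<in>carrier X. \<forall>x'\<in>carrier X. f (vadd X x x') = f x + f x'"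
    "\<forall>c. \<forall>x\<in>carrier X. f (vscale X c x) = c * f x" "vnorm X y \<le> norm (f y)"
    "\<forall>x\<in>carrier X. \<forall>r. f x = of_real r \<longrightarrow> r = u x" by blast
  have "norm (f x) \<le> vnorm X x" if x: "x \<in> carrier X" for x
  proof (cases "f x = 0")
    case True
    then show ?thesis using x by (simp add: norm_nonneg)
  next
    case False
    \<comment> \<open>A scalar of norm 1 that turns \<open>f x\<close> into the real number
      \<open>norm (f x)\<close>.\<close>
    define c where "c = of_real (norm (f x)) / f x"
    have "f (vscale X c x) = of_real (norm (f x))" using f(2) x False by (simp add: c_def)
    then have "norm (f x) = u (vscale X c x)" using f(4) x by simp
    also have "\<dots> \<le> vnorm X (vscale X c x)" using x by (simp add: u)
    also have "\<dots> = vnorm X x" using x False by (simp add: norm_scale c_def norm_divide)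
    finally show ?thesis .
  qed
  then show thesis using f by (intro that[of f]) auto
qed

section \<open>Operators, duals and Kolmogorov diameters\<close>

text \<open>\<open>bounded_ops\<close> without the bound: the rank argument is purely algebraic and
  is applied to evaluations and to differences of operators, where no bound then has to be
  checked.\<close>

definition linear_op :: "('k::real_normed_field, 'a) nspace \<Rightarrow> ('k, 'b) nspace \<Rightarrow> ('a \<Rightarrow> 'b) \<Rightarrow> bool" where
  "linear_op X Y U \<longleftrightarrow> U \<in> carrier X \<rightarrow> carrier Y \<and>
    (\<forall>x\<in>carrier X. \<forall>y\<in>carrier X. U (vadd X x y) = vadd Y (U x) (U y)) \<and>
    (\<forall>c. \<forall>x\<in>carrier X. U (vscale X c x) = vscale Y c (U x))"

lemma linear_opD:
  assumes "linear_op X Y U"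
  shows "x \<in> carrier X \<Longrightarrow> U x \<in> carrier Y"
    and "\<lbrakk>x \<in> carrier X; y \<in> carrier X\<rbrakk> \<Longrightarrow> U (vadd X x y) = vadd Y (U x) (U y)"
    and "x \<in> carrier X \<Longrightarrow> U (vscale X c x) = vscale Y c (U x)"
  using assms by (auto simp: linear_op_def)

lemma bounded_ops_iff:
  "T \<in> bounded_ops X Y \<longleftrightarrow>
    linear_op X Y T \<and> (\<exists>C. \<forall>x\<in>carrier X. vnorm Y (T x) \<le> C * vnorm X x)"
  by (auto simp: bounded_ops_def linear_op_def)

lemma bounded_ops_linear: "T \<in> bounded_ops X Y \<Longrightarrow> linear_op X Y T"
  by (simp add: bounded_ops_iff)

lemma linear_op_zero:
  assumes "normed_space X" "normed_space Y" "linear_op X Y U"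
  shows "U (vzero X) = vzero Y"
  using linear_opD[OF assms(3), of "vzero X"] normed_space.scale_zero_left[OF assms(1)]
    normed_space.scale_zero_left[OF assms(2)] normed_space.zero_closed[OF assms(1)] by metis

lemma linear_op_sub:
  assumes "normed_space Y" "linear_op X Y U" "linear_op X Y V"
  shows "linear_op X Y (\<lambda>x. vsub Y (U x) (V x))"
proof -
  interpret Y: normed_space Y by fact
  show ?thesis
    using linear_opD[OF assms(2)] linear_opD[OF assms(3)]
    by (auto simp: linear_op_def Y.scale_add_right Y.scale_scale Y.add_ac)
qed

text \<open>
  If \<open>U\<close> vanishes on the kernel of all but one functional, that functional is superfluous; otherwise
  some \<open>e\<close> of this kernel has \<open>U e \<noteq> 0\<close>, and subtracting a rank one operator from \<open>U\<close> makes it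
  vanish there.
\<close>

lemma range_in_span_of_common_kernel:
  assumes X: "normed_space X" and Y: "normed_space Y"
  shows "\<lbrakk>finite A; \<And>g. g \<in> A \<Longrightarrow> linear_op X scalar_space g; linear_op X Y U;
    \<And>x. \<lbrakk>x \<in> carrier X; \<forall>g\<in>A. g x = 0\<rbrakk> \<Longrightarrow> U x = vzero Y\<rbrakk> \<Longrightarrow>
    \<exists>C\<subseteq>carrier Y. finite C \<and> card C \<le> card A \<and> (\<forall>x\<in>carrier X. U x \<in> lin_span Y C)"
proof (induction A arbitrary: U rule: finite_induct)
  case empty
  interpret Y: normed_space Y by (fact Y)
  from empty show ?case by (intro exI[of _ "{}"]) (auto simp: Y.lin_span_empty)
next
  case (insert g A)
  interpret X: normed_space X by (fact X)
  interpret Y: normed_space Y by (fact Y)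
  have lin: "linear_op X scalar_space h" if "h \<in> A" for h using insert.prems(1) that by blast
  have g: "g (vadd X x y) = g x + g y" "g (vscale X c x) = c * g x"
    if "x \<in> carrier X" "y \<in> carrier X" for x y c
    using linear_opD(2,3)[OF insert.prems(1)[of g], of x] that by (auto simp: scalar_space_def)
  note U = linear_opD[OF insert.prems(2)]
  show ?case
  proof (cases "\<forall>x\<in>carrier X. (\<forall>h\<in>A. h x = 0) \<longrightarrow> U x = vzero Y")
    case True
    then obtain C where "C \<subseteq> carrier Y" "finite C" "card C \<le> card A" "\<forall>x\<in>carrier X. U x \<in> lin_span Y C"
      using insert.IH[OF lin insert.prems(2)] by blast
    then show ?thesis using insert.hyps by (intro exI[of _ C]) auto
  next
    case False
    then obtain e where e [simp]: "e \<in> carrier X" and eA: "\<forall>h\<in>A. h e = 0" and "U e \<noteq> vzero Y" by blast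
    then have ge: "g e \<noteq> 0" using insert.prems(3)[of e] by auto
    define V where "V x = vadd Y (U x) (vscale Y (- (g x / g e)) (U e))" for x
    have "linear_op X Y V"
      unfolding linear_op_def V_def
      by (auto simp: U g Y.scale_add_right Y.scale_scale Y.add_ac add_divide_distrib algebra_simps
          simp flip: Y.scale_add_left)
    moreover have "V x = vzero Y" if x: "x \<in> carrier X" "\<forall>h\<in>A. h x = 0" for x
    proof -
      \<comment> \<open>The projection of \<open>x\<close> along \<open>e\<close> into the kernel of
        \<open>g\<close>. It remains in the kernel of \<open>A\<close>, since \<open>e\<close> lies
        there, and \<open>V x = U z\<close>.\<close>
      define z where "z = vadd X x (vscale X (- (g x / g e)) e)"
      have "h z = 0" if "h \<in> A" for h
        using linear_opD(2,3)[OF lin[OF that]] x(1) bspec[OF x(2) that] bspec[OF eA that]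
        by (simp add: z_def scalar_space_def)
      moreover have "g z = 0" using x ge by (simp add: z_def g)
      ultimately have "U z = vzero Y" using x by (intro insert.prems(3)) (auto simp: z_def)
      then show ?thesis using x by (simp add: V_def z_def U)
    qed
    ultimately obtain C where C: "C \<subseteq> carrier Y" "finite C" "card C \<le> card A"
      "\<forall>x\<in>carrier X. V x \<in> lin_span Y C"
      using insert.IH[OF lin, of V] by blast
    have "U x \<in> lin_span Y (insert (U e) C)" if x: "x \<in> carrier X" for x
    proof -
      have "U x = vadd Y (V x) (vscale Y (g x / g e) (U e))"
        using x by (simp add: V_def U Y.add_assoc Y.scale_zero_left Y.add_zero flip: Y.scale_add_left)
      then show ?thesis
        unfolding Y.lin_span_insert[OF C(1) U(1)[OF e]] using C(4) x by blast
    qed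
    moreover have "card (insert (U e) C) \<le> card (insert g A)"
      using C insert.hyps by (simp add: card_insert_if)
    ultimately show ?thesis using C U(1)[OF e] by (intro exI[of _ "insert (U e) C"]) auto
  qed
qed

section \<open>Operator norms\<close>

lemma op_norm_le:
  assumes "normed_space X" "\<And>x. \<lbrakk>x \<in> carrier X; vnorm X x \<le> 1\<rbrakk> \<Longrightarrow> vnorm Y (T x) \<le> C"
  shows "op_norm X Y T \<le> C"
  unfolding op_norm_def
  using assms normed_space.zero_closed[OF assms(1)] normed_space.norm_zero[OF assms(1)]
  by (intro cSup_least) (auto intro: exI[of _ "vzero X"])

lemma op_norm_ge:
  assumes X: "normed_space X" and T: "T \<in> bounded_ops X Y"
    and x: "x \<in> carrier X" "vnorm X x \<le> 1"
  shows "vnorm Y (T x) \<le> op_norm X Y T"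
proof -
  interpret normed_space X by fact
  obtain C where C: "\<forall>x\<in>carrier X. vnorm Y (T x) \<le> C * vnorm X x"
    using T by (auto simp: bounded_ops_iff)
  \<comment> \<open>The constant \<open>C\<close> need not be nonnegative, hence the absolute
    value.\<close>
  have "vnorm Y (T z) \<le> \<bar>C\<bar>" if "z \<in> carrier X" "vnorm X z \<le> 1" for z
  proof -
    have "C * vnorm X z \<le> \<bar>C\<bar> * 1"
      using that norm_nonneg[of z] by (intro mult_mono) auto
    then show ?thesis using C that by force
  qed
  then have "bdd_above {vnorm Y (T x) | x. x \<in> carrier X \<and> vnorm X x \<le> 1}"
    by (intro bdd_aboveI[of _ "\<bar>C\<bar>"]) auto
  then show ?thesis unfolding op_norm_def using x by (intro cSup_upper) auto
qed

lemma op_norm_bound: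
  assumes X: "normed_space X" and Y: "normed_space Y" and T: "T \<in> bounded_ops X Y"
    and x: "x \<in> carrier X"
  shows "vnorm Y (T x) \<le> op_norm X Y T * vnorm X x"
proof -
  interpret X: normed_space X by (fact X)
  interpret Y: normed_space Y by (fact Y)
  note lin = bounded_ops_linear[OF T]
  show ?thesis
  proof (cases "vnorm X x = 0")
    case True
    then have "x = vzero X" using x by (intro X.norm_eq_zero)
    then show ?thesis by (simp add: linear_op_zero[OF X Y lin] X.norm_zero Y.norm_zero)
  next
    case False
    then have pos: "0 < vnorm X x" using X.norm_nonneg[OF x] by simp
    define z where "z = vscale X (of_real (1 / vnorm X x)) x"
    have "vnorm X z = 1" using x pos by (simp add: z_def X.norm_scale norm_divide)
    then have "vnorm Y (T z) \<le> op_norm X Y T" using x by (intro op_norm_ge X T) (auto simp: z_def)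
    moreover have "vnorm Y (T z) = vnorm Y (T x) / vnorm X x"
      using x pos linear_opD[OF lin] by (simp add: z_def Y.norm_scale norm_divide)
    ultimately show ?thesis using pos by (simp add: field_simps)
  qed
qed

lemma op_norm_nonneg:
  assumes "normed_space X" "normed_space Y" "T \<in> bounded_ops X Y"
  shows "0 \<le> op_norm X Y T"
  using op_norm_ge[OF assms(1,3), of "vzero X"] linear_op_zero[OF assms(1,2) bounded_ops_linear[OF assms(3)]]
    normed_space.zero_closed[OF assms(1)] normed_space.norm_zero[OF assms(1)]
    normed_space.norm_zero[OF assms(2)] by simp

section \<open>Dual spaces and adjoints\<close>

lemma normed_space_scalar: "normed_space scalar_space"
  by unfold_locales (auto simp: scalar_space_def algebra_simps norm_mult norm_triangle_ineq)

lemma dual_space_simps [simp]: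
  "vzero (dual_space X) = (\<lambda>x. 0)"
  "vadd (dual_space X) f g = (\<lambda>x. f x + g x)"
  "vscale (dual_space X) c f = (\<lambda>x. c * f x)"
  "vnorm (dual_space X) f = op_norm X scalar_space f"
  by (simp_all add: dual_space_def)

lemma dual_carrier_iff:
  "f \<in> carrier (dual_space X) \<longleftrightarrow> f \<in> bounded_ops X scalar_space \<and> (\<forall>x. x \<notin> carrier X \<longrightarrow> f x = 0)"
  by (simp add: dual_space_def)

lemma bounded_functional_iff:
  "f \<in> bounded_ops X scalar_space \<longleftrightarrow>
    (\<forall>x\<in>carrier X. \<forall>y\<in>carrier X. f (vadd X x y) = f x + f y) \<and>
    (\<forall>c. \<forall>x\<in>carrier X. f (vscale X c x) = c * f x) \<and>
    (\<exists>C. \<forall>x\<in>carrier X. norm (f x) \<le> C * vnorm X x)"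
  by (simp add: bounded_ops_def scalar_space_def)

lemma functional_norm_le:
  "\<lbrakk>normed_space X; \<And>x. \<lbrakk>x \<in> carrier X; vnorm X x \<le> 1\<rbrakk> \<Longrightarrow> norm (f x) \<le> C\<rbrakk> \<Longrightarrow>
    op_norm X scalar_space f \<le> C"
  using op_norm_le[of X scalar_space f C] by (simp add: scalar_space_def)

lemma functional_norm_ge:
  "\<lbrakk>normed_space X; f \<in> bounded_ops X scalar_space; x \<in> carrier X; vnorm X x \<le> 1\<rbrakk> \<Longrightarrow>
    norm (f x) \<le> op_norm X scalar_space f"
  using op_norm_ge[of X f scalar_space x] by (simp add: scalar_space_def)

lemma functional_norm_bound:
  "\<lbrakk>normed_space X; f \<in> bounded_ops X scalar_space; x \<in> carrier X\<rbrakk> \<Longrightarrow>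
    norm (f x) \<le> op_norm X scalar_space f * vnorm X x"
  using op_norm_bound[OF _ normed_space_scalar, of X f x] by (simp add: scalar_space_def)

text \<open>Functionals vanish outside the carrier, so norm zero yields the zero function on the
  whole type. For homogeneity, the easy inequality is applied once to \<open>c\<close> and once to
  \<open>inverse c\<close>.\<close>

lemma normed_space_dual:
  assumes X: "normed_space X"
  shows "normed_space (dual_space X)"
proof -
  interpret X: normed_space X by fact
  have add: "(\<lambda>x. f x + g x) \<in> bounded_ops X scalar_space"
    if f: "f \<in> bounded_ops X scalar_space" and g: "g \<in> bounded_ops X scalar_space" for f g
  proof -
    have "norm (f x + g x) \<le> (op_norm X scalar_space f + op_norm X scalar_space g) * vnorm X x"
      if "x \<in> carrier X" for x
      using norm_triangle_ineq[of "f x" "g x"] functional_norm_bound[OF X f that]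
        functional_norm_bound[OF X g that] by (simp add: distrib_right)
    then have "\<exists>C. \<forall>x\<in>carrier X. norm (f x + g x) \<le> C * vnorm X x" by blast
    then show ?thesis using f g by (simp add: bounded_functional_iff algebra_simps)
  qed
  have scale: "(\<lambda>x. c * f x) \<in> bounded_ops X scalar_space" if f: "f \<in> bounded_ops X scalar_space" for c f
  proof -
    have "norm (c * f x) \<le> (norm c * op_norm X scalar_space f) * vnorm X x" if "x \<in> carrier X" for x
      using functional_norm_bound[OF X f that] by (simp add: norm_mult mult_left_mono mult.assoc)
    then have "\<exists>C. \<forall>x\<in>carrier X. norm (c * f x) \<le> C * vnorm X x" by blast
    then show ?thesis using f by (simp add: bounded_functional_iff algebra_simps)
  qed
  have scale_le: "op_norm X scalar_space (\<lambda>x. c * f x) \<le> norm c * op_norm X scalar_space f"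
    if f: "f \<in> bounded_ops X scalar_space" for c f
    using functional_norm_ge[OF X f]
    by (intro functional_norm_le X) (simp add: norm_mult mult_left_mono)
  show ?thesis
  proof
    show "vzero (dual_space X) \<in> carrier (dual_space X)"
      by (auto simp: dual_carrier_iff bounded_functional_iff intro: exI[of _ 0])
  next
    fix f assume f: "f \<in> carrier (dual_space X)" "vnorm (dual_space X) f = 0"
    have "f x = 0" for x
      using functional_norm_bound[OF X, of f x] f by (cases "x \<in> carrier X") (auto simp: dual_carrier_iff)
    then show "f = vzero (dual_space X)" by auto
  next
    fix f g assume "f \<in> carrier (dual_space X)" "g \<in> carrier (dual_space X)"
    then have fg: "f \<in> bounded_ops X scalar_space" "g \<in> bounded_ops X scalar_space"
      by (auto simp: dual_carrier_iff)
    have "norm (f x + g x) \<le> op_norm X scalar_space f + op_norm X scalar_space g"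
      if "x \<in> carrier X" "vnorm X x \<le> 1" for x
      using norm_triangle_ineq[of "f x" "g x"] functional_norm_ge[OF X fg(1) that]
        functional_norm_ge[OF X fg(2) that] by simp
    then show "vnorm (dual_space X) (vadd (dual_space X) f g) \<le> vnorm (dual_space X) f + vnorm (dual_space X) g"
      by (auto intro: functional_norm_le X)
  next
    fix c f assume "f \<in> carrier (dual_space X)"
    then have f: "f \<in> bounded_ops X scalar_space" by (simp add: dual_carrier_iff)
    have "norm c * op_norm X scalar_space f \<le> op_norm X scalar_space (\<lambda>x. c * f x)"
    proof (cases "c = 0")
      case True
      then show ?thesis using op_norm_nonneg[OF X normed_space_scalar scale[OF f, of 0]] by simp
    next
      case False
      then show ?thesis using scale_le[OF scale[OF f, of c], of "inverse c"]
        by (simp add: norm_divide field_simps)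
    qed
    with scale_le[OF f]
    show "vnorm (dual_space X) (vscale (dual_space X) c f) = norm c * vnorm (dual_space X) f"
      by (simp add: antisym)
  qed (auto simp: dual_carrier_iff add scale algebra_simps)
qed

lemma adjoint_bounded:
  assumes X: "normed_space X" and Y: "normed_space Y" and T: "T \<in> bounded_ops X Y"
  shows "adjoint_op X T \<in> bounded_ops (dual_space Y) (dual_space X)"
proof -
  interpret X: normed_space X by (fact X)
  note T' = linear_opD[OF bounded_ops_linear[OF T]]
  have le: "norm (g (T x)) \<le> (op_norm X Y T * op_norm Y scalar_space g) * vnorm X x"
    if g: "g \<in> bounded_ops Y scalar_space" and x: "x \<in> carrier X" for g x
  proof -
    have "norm (g (T x)) \<le> op_norm Y scalar_space g * vnorm Y (T x)"
      using functional_norm_bound[OF Y g] T'(1) x by simp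
    also have "\<dots> \<le> op_norm Y scalar_space g * (op_norm X Y T * vnorm X x)"
      using op_norm_bound[OF X Y T x] op_norm_nonneg[OF Y normed_space_scalar g] by (intro mult_left_mono)
    finally show ?thesis by (simp add: mult_ac)
  qed
  have cl: "adjoint_op X T g \<in> carrier (dual_space X)" if "g \<in> carrier (dual_space Y)" for g
  proof -
    have g: "g \<in> bounded_ops Y scalar_space" using that by (simp add: dual_carrier_iff)
    have "\<exists>C. \<forall>x\<in>carrier X. norm (g (T x)) \<le> C * vnorm X x" using le[OF g] by blast
    then show ?thesis using g
      by (simp add: dual_carrier_iff bounded_functional_iff adjoint_op_def T')
  qed
  have "op_norm X scalar_space (adjoint_op X T g) \<le> op_norm X Y T * op_norm Y scalar_space g"
    if "g \<in> carrier (dual_space Y)" for g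
  proof (rule functional_norm_le[OF X])
    fix x assume x: "x \<in> carrier X" "vnorm X x \<le> 1"
    have g: "g \<in> bounded_ops Y scalar_space" using that by (simp add: dual_carrier_iff)
    have "0 \<le> op_norm X Y T * op_norm Y scalar_space g"
      using op_norm_nonneg[OF X Y T] op_norm_nonneg[OF Y normed_space_scalar g] by simp
    then have "(op_norm X Y T * op_norm Y scalar_space g) * vnorm X x
        \<le> op_norm X Y T * op_norm Y scalar_space g"
      using x by (intro mult_left_le) auto
    then show "norm (adjoint_op X T g x) \<le> op_norm X Y T * op_norm Y scalar_space g"
      using le[OF g x(1)] x by (simp add: adjoint_op_def)
  qed
  then have "\<exists>C. \<forall>g\<in>carrier (dual_space Y).
      vnorm (dual_space X) (adjoint_op X T g) \<le> C * vnorm (dual_space Y) g" by auto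
  moreover have "linear_op (dual_space Y) (dual_space X) (adjoint_op X T)"
    using cl by (simp add: linear_op_def) (simp add: adjoint_op_def fun_eq_iff)
  ultimately show ?thesis by (simp only: bounded_ops_iff)
qed

section \<open>Quotients and bounds for Kolmogorov diameters\<close>

context normed_space
begin

text \<open>This bound and \<open>quot_norm_ge\<close> describe the quotient norm as the infimum
  over a coset. They hold for subspaces that are not closed too, where the quotient norm is only a
  seminorm.\<close>

lemma quot_norm_le:
  assumes G: "lin_subspace G X" and x: "x \<in> carrier X" and g: "g \<in> G"
  shows "vnorm (quot_space X G) (quot_map X G x) \<le> vnorm X (vadd X x g)"
proof -
  have "bdd_below (vnorm X ` quot_map X G x)"
    using G x by (intro bdd_belowI2[of _ 0]) (auto simp: quot_map_def lin_subspace_def intro!: norm_nonneg)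
  then show ?thesis using g by (auto simp: quot_space_def quot_map_def intro!: cInf_lower)
qed

lemma quot_norm_ge:
  assumes "lin_subspace G X" and "\<And>g. g \<in> G \<Longrightarrow> e \<le> vnorm X (vadd X x g)"
  shows "e \<le> vnorm (quot_space X G) (quot_map X G x)"
  using assms by (auto simp: quot_space_def quot_map_def lin_subspace_def intro!: cInf_greatest)

lemma quot_map_eqD:
  assumes "lin_subspace G X" "x \<in> carrier X" "quot_map X G x = quot_map X G y"
  obtains g where "g \<in> G" "x = vadd X y g"
proof -
  have "x \<in> quot_map X G x"
    using assms(1,2) unfolding quot_map_def lin_subspace_def
    by (intro image_eqI[of _ _ "vzero X"]) (auto simp: add_zero)
  then show thesis using that unfolding assms(3) by (auto simp: quot_map_def)
qed

lemma linear_op_quot_map: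
  assumes G: "lin_subspace G X"
  shows "linear_op X (quot_space X G) (quot_map X G)"
proof -
  have Gc: "g \<in> carrier X" if "g \<in> G" for g using G that by (auto simp: lin_subspace_def)
  have zG: "vzero X \<in> G" using G by (simp add: lin_subspace_def)
  have "quot_map X G (vadd X x y) = {vadd X a b | a b. a \<in> quot_map X G x \<and> b \<in> quot_map X G y}"
    if x: "x \<in> carrier X" and y: "y \<in> carrier X" for x y
  proof (intro equalityI subsetI)
    fix z assume "z \<in> quot_map X G (vadd X x y)"
    then obtain g where g: "g \<in> G" and z: "z = vadd X (vadd X x y) g" by (auto simp: quot_map_def)
    have "z = vadd X (vadd X x g) (vadd X y (vzero X))"
      using x y Gc[OF g] by (simp add: z add_zero add_ac)
    then show "z \<in> {vadd X a b | a b. a \<in> quot_map X G x \<and> b \<in> quot_map X G y}"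
      using g zG by (auto simp: quot_map_def)
  next
    fix z assume "z \<in> {vadd X a b | a b. a \<in> quot_map X G x \<and> b \<in> quot_map X G y}"
    then obtain f g where fg: "f \<in> G" "g \<in> G" and z: "z = vadd X (vadd X x f) (vadd X y g)"
      by (auto simp: quot_map_def)
    have "z = vadd X (vadd X x y) (vadd X f g)"
      using x y fg[THEN Gc] by (simp add: z add_ac)
    then show "z \<in> quot_map X G (vadd X x y)" using G fg by (auto simp: quot_map_def lin_subspace_def)
  qed
  moreover have "quot_map X G (vscale X c x) = {vadd X (vscale X c a) f | a f. a \<in> quot_map X G x \<and> f \<in> G}"
    if x: "x \<in> carrier X" for c x
  proof (intro equalityI subsetI)
    fix z assume "z \<in> quot_map X G (vscale X c x)"
    then obtain g where g: "g \<in> G" and z: "z = vadd X (vscale X c x) g" by (auto simp: quot_map_def)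
    have "x \<in> quot_map X G x" using zG x unfolding quot_map_def
      by (intro image_eqI[of _ _ "vzero X"]) (auto simp: add_zero)
    then show "z \<in> {vadd X (vscale X c a) f | a f. a \<in> quot_map X G x \<and> f \<in> G}" using g z by blast
  next
    fix z assume "z \<in> {vadd X (vscale X c a) f | a f. a \<in> quot_map X G x \<and> f \<in> G}"
    then obtain f g where fg: "f \<in> G" "g \<in> G" and z: "z = vadd X (vscale X c (vadd X x f)) g"
      by (auto simp: quot_map_def)
    have "z = vadd X (vscale X c x) (vadd X (vscale X c f) g)"
      using x fg[THEN Gc] by (simp add: z scale_add_right add_assoc)
    then show "z \<in> quot_map X G (vscale X c x)" using G fg by (auto simp: quot_map_def lin_subspace_def)
  qed
  ultimately show ?thesis by (auto simp: linear_op_def quot_space_def)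
qed

lemma bounded_ops_quot_map_comp:
  assumes Z: "normed_space Z" and R: "R \<in> bounded_ops Z X" and G: "lin_subspace G X"
  shows "quot_map X G \<circ> R \<in> bounded_ops Z (quot_space X G)"
proof -
  note R' = linear_opD[OF bounded_ops_linear[OF R]]
  note Q = linear_opD[OF linear_op_quot_map[OF G]]
  have "vnorm (quot_space X G) (quot_map X G (R z)) \<le> op_norm Z X R * vnorm Z z" if z: "z \<in> carrier Z" for z
    using quot_norm_le[OF G R'(1)[OF z], of "vzero X"] op_norm_bound[OF Z _ R z] normed_space_axioms
      G R'(1)[OF z] by (simp add: add_zero lin_subspace_def)
  then show ?thesis by (auto simp: bounded_ops_iff linear_op_def Q R')
qed

text \<open>The competing subspace may be given by any spanning set of at most \<open>n\<close>
  vectors, independent or not. The infimum can be compared with its value there because all quotient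
  norms are nonnegative.\<close>

lemma kolmogorov_diameter_le:
  assumes Z: "normed_space Z" and R: "R \<in> bounded_ops Z X"
    and C: "finite C" "C \<subseteq> carrier X" "card C \<le> n"
    and le: "\<And>z. \<lbrakk>z \<in> carrier Z; vnorm Z z \<le> 1\<rbrakk> \<Longrightarrow> \<exists>g\<in>lin_span X C. vnorm X (vadd X (R z) g) \<le> d"
  shows "kolmogorov_diameter n Z X R \<le> d"
proof -
  interpret Z: normed_space Z by (fact Z)
  note R' = linear_opD[OF bounded_ops_linear[OF R]]
  let ?q = "\<lambda>G. op_norm Z (quot_space X G) (quot_map X G \<circ> R)"
  have G: "lin_subspace (lin_span X C) X" using C(2) by (rule lin_subspace_span)
  have "0 \<le> ?q G" if "lin_subspace G X" for G
  proof -
    have "0 \<le> vnorm (quot_space X G) (quot_map X G (R (vzero Z)))"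
      using that R'(1)[of "vzero Z"] by (intro quot_norm_ge) (auto intro!: norm_nonneg simp: lin_subspace_def)
    also have "\<dots> \<le> ?q G"
      using op_norm_ge[OF Z bounded_ops_quot_map_comp[OF Z R that], of "vzero Z"] by (simp add: Z.norm_zero)
    finally show ?thesis .
  qed
  then have "bdd_below {?q G | G. lin_subspace G X \<and> has_dim_at_most X G n}"
    by (intro bdd_belowI[of _ 0]) auto
  then have "kolmogorov_diameter n Z X R \<le> ?q (lin_span X C)"
    unfolding kolmogorov_diameter_def using G has_dim_at_most_span[OF C] by (intro cInf_lower) auto
  also have "\<dots> \<le> d"
  proof (rule op_norm_le[OF Z])
    fix z assume z: "z \<in> carrier Z" "vnorm Z z \<le> 1"
    then obtain g where "g \<in> lin_span X C" "vnorm X (vadd X (R z) g) \<le> d" using le by blast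
    then show "vnorm (quot_space X (lin_span X C)) ((quot_map X (lin_span X C) \<circ> R) z) \<le> d"
      using quot_norm_le[OF G R'(1)[OF z(1)]] by force
  qed
  finally show ?thesis .
qed

text \<open>The zero subspace is admissible for every \<open>n\<close>, so the infimum is over a
  nonempty set, and every admissible subspace is the span of a finite basis.\<close>

lemma kolmogorov_diameter_ge:
  assumes "\<And>B. \<lbrakk>finite B; B \<subseteq> carrier X; card B \<le> n\<rbrakk> \<Longrightarrow>
      e \<le> op_norm Z (quot_space X (lin_span X B)) (quot_map X (lin_span X B) \<circ> R)"
  shows "e \<le> kolmogorov_diameter n Z X R"
  unfolding kolmogorov_diameter_def
proof (rule cInf_greatest)
  have "lin_subspace {vzero X} X" "has_dim_at_most X {vzero X} n"
    using lin_subspace_zero has_dim_at_most_span[of "{}" n] by (auto simp: lin_span_empty)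
  then show "{op_norm Z (quot_space X G) (quot_map X G \<circ> R) | G. lin_subspace G X \<and> has_dim_at_most X G n} \<noteq> {}"
    by blast
next
  fix r assume "r \<in> {op_norm Z (quot_space X G) (quot_map X G \<circ> R) | G. lin_subspace G X \<and> has_dim_at_most X G n}"
  then obtain G B where r: "r = op_norm Z (quot_space X G) (quot_map X G \<circ> R)" "lin_subspace G X"
    and B: "B \<subseteq> G" "lin_span X B = G" "finite B" "card B \<le> n"
    by (auto simp: has_dim_at_most_def lin_basis_def)
  then show "e \<le> r" using assms[OF B(3) _ B(4)] by (auto simp: lin_subspace_def)
qed

end

section \<open>The two inequalities, by extension and by lifting\<close>

theorem kolmogorov_diameter_adjoint_ge:
  fixes X Y :: "('k::real_normed_field, 'a) nspace"
  assumes bX: "banach_space X" and bY: "banach_space Y" and ext: "metric_extension_property Y"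
    and T: "T \<in> bounded_ops X Y"
  shows "kolmogorov_diameter n X Y T \<le> kolmogorov_diameter n (dual_space Y) (dual_space X) (adjoint_op X T)"
proof -
  have X: "normed_space X" and Y: "normed_space Y" using bX bY by (auto simp: banach_space_def)
  interpret X: normed_space X by (fact X)
  interpret Y: normed_space Y by (fact Y)
  interpret X': normed_space "dual_space X" using X by (rule normed_space_dual)
  have Y': "normed_space (dual_space Y)" using Y by (rule normed_space_dual)
  note T' = linear_opD[OF bounded_ops_linear[OF T]]
  show ?thesis
  proof (rule X'.kolmogorov_diameter_ge)
    fix B assume B: "finite B" "B \<subseteq> carrier (dual_space X)" "card B \<le> n"
    define H where "H = lin_span (dual_space X) B"
    define d where "d = op_norm (dual_space Y) (quot_space (dual_space X) H) (quot_map (dual_space X) H \<circ> adjoint_op X T)"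
    have H: "lin_subspace H (dual_space X)" unfolding H_def using B(2) by (rule X'.lin_subspace_span)
    define M where "M = {x \<in> carrier X. \<forall>g\<in>H. g x = 0}"
    have lin: "g \<in> bounded_ops X scalar_space" if "g \<in> H" for g
      using H that by (auto simp: lin_subspace_def dual_carrier_iff)
    have MX: "M \<subseteq> carrier X" by (auto simp: M_def)
    have "closed_subspace M X"
      unfolding X.closed_subspace_iff
    proof (intro conjI ballI)
      have g0: "g (vzero X) = 0" if "g \<in> H" for g
        using linear_op_zero[OF X normed_space_scalar bounded_ops_linear[OF lin[OF that]]]
        by (simp add: scalar_space_def)
      show "lin_subspace M X"
        unfolding lin_subspace_def
      proof (intro conjI ballI allI)
        show "M \<subseteq> carrier X" by (fact MX)
        show "vzero X \<in> M" unfolding M_def using g0 X.zero_closed by blast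
      next
        fix x y assume "x \<in> M" "y \<in> M"
        then have xy: "x \<in> carrier X" "y \<in> carrier X" and "\<And>g. g \<in> H \<Longrightarrow> g x = 0 \<and> g y = 0"
          unfolding M_def by blast+
        then have "g (vadd X x y) = 0" if "g \<in> H" for g
          using lin[OF that] that xy unfolding bounded_functional_iff by (metis add_0)
        then show "vadd X x y \<in> M" unfolding M_def using xy X.add_closed by blast
      next
        fix c x assume "x \<in> M"
        then have x: "x \<in> carrier X" and "\<And>g. g \<in> H \<Longrightarrow> g x = 0"
          unfolding M_def by blast+
        then have "g (vscale X c x) = 0" if "g \<in> H" for g
          using lin[OF that] that x unfolding bounded_functional_iff by (metis mult_zero_right)
        then show "vscale X c x \<in> M" unfolding M_def using x X.scale_closed by blast
      qed
    next
      fix x assume x: "x \<in> carrier X - M"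
      then obtain g where g: "g \<in> H" "g x \<noteq> 0" by (auto simp: M_def)
      let ?N = "op_norm X scalar_space g"
      have "norm (g x) \<le> ?N * vnorm X x" using functional_norm_bound[OF X lin[OF g(1)]] x by simp
      then have "0 < ?N"
        using g(2) op_norm_nonneg[OF X normed_space_scalar lin[OF g(1)]] by (cases "?N = 0") auto
      \<comment> \<open>Since \<open>g\<close> vanishes on \<open>M\<close>, it takes the same value
        at \<open>x - m\<close> as at \<open>x\<close>.\<close>
      have "norm (g x) / ?N \<le> vnorm X (vsub X x m)" if m: "m \<in> M" for m
      proof -
        have "g (vsub X x m) = g x"
          using lin[OF g(1)] x m g(1) by (simp add: bounded_functional_iff M_def)
        then have "norm (g x) \<le> ?N * vnorm X (vsub X x m)"
          using functional_norm_bound[OF X lin[OF g(1)], of "vsub X x m"] x m MX by auto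
        then show ?thesis using \<open>0 < ?N\<close> by (simp add: field_simps)
      qed
      then show "\<exists>d>0. \<forall>f\<in>M. d \<le> vnorm X (vsub X x f)"
        using \<open>0 < ?N\<close> g(2) by (intro exI[of _ "norm (g x) / ?N"]) auto
    qed
    then have subM: "lin_subspace M X" and clM: "closed_subspace M X" by (auto simp: closed_subspace_def)
    have le_d: "vnorm Y (T x) \<le> d" if x: "x \<in> M" "vnorm X x \<le> 1" for x
    proof -
      have xX: "x \<in> carrier X" using x MX by auto
      \<comment> \<open>A functional of norm at most 1 that attains the norm of \<open>T x\<close>;
        \<open>g\<close> below is its representative in \<open>dual_space Y\<close>.\<close>
      obtain f :: "'a \<Rightarrow> 'k" where f: "\<And>y y'. \<lbrakk>y \<in> carrier Y; y' \<in> carrier Y\<rbrakk> \<Longrightarrow> f (vadd Y y y') = f y + f y'"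
        "\<And>c y. y \<in> carrier Y \<Longrightarrow> f (vscale Y c y) = c * f y"
        "\<And>y. y \<in> carrier Y \<Longrightarrow> norm (f y) \<le> vnorm Y y" "vnorm Y (T x) \<le> norm (f (T x))"
        using Y.norming_functional[OF T'(1)[OF xX]] by blast
      define g where "g y = (if y \<in> carrier Y then f y else 0)" for y
      have g: "g \<in> carrier (dual_space Y)"
        using f by (auto simp: g_def dual_carrier_iff bounded_functional_iff intro: exI[of _ 1])
      have "op_norm Y scalar_space g \<le> 1"
        using f(3) by (intro functional_norm_le[OF Y]) (force simp: g_def)
      then have "vnorm (quot_space (dual_space X) H) (quot_map (dual_space X) H (adjoint_op X T g)) \<le> d"
        unfolding d_def
        using op_norm_ge[OF Y' X'.bounded_ops_quot_map_comp[OF Y' adjoint_bounded[OF X Y T] H] g] by simp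
      moreover have "norm (g (T x)) \<le>
          vnorm (quot_space (dual_space X) H) (quot_map (dual_space X) H (adjoint_op X T g))"
      proof (rule X'.quot_norm_ge[OF H])
        \<comment> \<open>Every \<open>h\<close> in \<open>H\<close> vanishes at \<open>x\<close>,
          so adding it to the adjoint image of \<open>g\<close> leaves the value
          \<open>g (T x)\<close> at \<open>x\<close> unchanged.\<close>
        fix h assume h: "h \<in> H"
        have "vadd (dual_space X) (adjoint_op X T g) h \<in> carrier (dual_space X)"
          using h H linear_opD(1)[OF bounded_ops_linear[OF adjoint_bounded[OF X Y T]] g]
          by (intro X'.add_closed) (auto simp: lin_subspace_def)
        then have "(\<lambda>z. adjoint_op X T g z + h z) \<in> bounded_ops X scalar_space"
          by (simp add: dual_carrier_iff)
        moreover have "h x = 0" using h x(1) unfolding M_def by blast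
        ultimately show "norm (g (T x)) \<le> vnorm (dual_space X) (vadd (dual_space X) (adjoint_op X T g) h)"
          using functional_norm_ge[OF X _ xX x(2), of "\<lambda>z. adjoint_op X T g z + h z"] xX
          by (simp add: adjoint_op_def)
      qed
      moreover have "vnorm Y (T x) \<le> norm (g (T x))" using f(4) T'(1)[OF xX] by (simp add: g_def)
      ultimately show ?thesis by linarith
    qed
    have sub: "normed_space (sub_nspace X M)"
      using subM MX unfolding sub_nspace_def lin_subspace_def
      by unfold_locales (auto simp: subset_iff X.add_ac X.add_zero X.add_inverse
          X.scale_add_right X.scale_add_left X.scale_scale X.scale_one X.norm_eq_zero X.norm_triangle X.norm_scale)
    have "T \<in> bounded_ops (sub_nspace X M) Y"
      using T MX unfolding bounded_ops_def sub_nspace_def by (auto 4 4 simp: subset_iff)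
    \<comment> \<open>The extension property of \<open>Y\<close> is used for the ambient space
      \<open>X\<close>, which is why both carriers lie in one type.\<close>
    then obtain S where S: "S \<in> bounded_ops X Y" "\<forall>x\<in>M. T x = S x"
      and "op_norm X Y S = op_norm (sub_nspace X M) Y T"
      using ext bX clM unfolding metric_extension_property_def by blast
    moreover have "op_norm (sub_nspace X M) Y T \<le> d"
      using le_d by (intro op_norm_le sub) (auto simp: sub_nspace_def)
    ultimately have Sd: "op_norm X Y S \<le> d" by simp
    \<comment> \<open>The difference vanishes on \<open>M\<close>, which is already the common
      kernel of the finite set \<open>B\<close>. Hence its range is spanned by at most
      \<open>card B\<close> vectors.\<close>
    define U where "U x = vsub Y (T x) (S x)" for x
    have linU: "linear_op X Y U"
      unfolding U_def using S T by (intro linear_op_sub Y bounded_ops_linear)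
    have "U x = vzero Y" if x: "x \<in> carrier X" "\<forall>g\<in>B. g x = 0" for x
    proof -
      have "lin_subspace {g \<in> carrier (dual_space X). g x = 0} (dual_space X)"
        unfolding lin_subspace_def using X'.zero_closed X'.add_closed X'.scale_closed by auto
      then have "H \<subseteq> {g \<in> carrier (dual_space X). g x = 0}"
        unfolding H_def using B x by (intro X'.lin_span_minimal) auto
      then have "x \<in> M" using x by (auto simp: M_def)
      then have "S x = T x" using S(2) by simp
      then show ?thesis using T'(1)[OF x(1)] by (simp add: U_def Y.add_inverse)
    qed
    moreover have "linear_op X scalar_space g" if "g \<in> B" for g
      using that B by (auto simp: dual_carrier_iff bounded_ops_iff)
    ultimately obtain C where C: "C \<subseteq> carrier Y" "finite C" "card C \<le> card B"
      "\<forall>x\<in>carrier X. U x \<in> lin_span Y C"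
      using range_in_span_of_common_kernel[OF X Y B(1) _ linU] by blast
    have "kolmogorov_diameter n X Y T \<le> d"
    proof (rule Y.kolmogorov_diameter_le[OF X T C(2,1)])
      show "card C \<le> n" using C B by simp
      fix x assume x: "x \<in> carrier X" "vnorm X x \<le> 1"
      note S' = linear_opD[OF bounded_ops_linear[OF S(1)]]
      \<comment> \<open>Correcting \<open>T x\<close> by the finite-rank part leaves
        \<open>S x\<close>, whose norm is at most \<open>d\<close> on the unit ball.\<close>
      have "vsub Y (T x) (U x) = S x"
        using x T'(1) S'(1) by (simp add: U_def Y.minus_vsub Y.add_commute[of "S x"] Y.add_sub_cancel)
      then have "vnorm Y (vsub Y (T x) (U x)) \<le> d"
        using op_norm_ge[OF X S(1) x] Sd by simp
      moreover have "vscale Y (-1) (U x) \<in> lin_span Y C"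
        using C(4) x Y.lin_subspace_span[OF C(1)] by (auto simp: lin_subspace_def)
      ultimately show "\<exists>g\<in>lin_span Y C. vnorm Y (vadd Y (T x) g) \<le> d" by blast
    qed
    then show "kolmogorov_diameter n X Y T \<le> op_norm (dual_space Y)
        (quot_space (dual_space X) (lin_span (dual_space X) B))
        (quot_map (dual_space X) (lin_span (dual_space X) B) \<circ> adjoint_op X T)"
      by (simp add: d_def H_def)
  qed
qed

text \<open>A lifting of the quotient operator has nearly the same norm and differs from
  \<open>T\<close> by an operator into \<open>G\<close>. The adjoint of this difference depends only
  on the values of a functional on a basis of \<open>G\<close>.\<close>

theorem kolmogorov_diameter_adjoint_le:
  fixes X Y :: "('k::real_normed_field, 'a) nspace"
  assumes X: "normed_space X" and bY: "banach_space Y" and lift: "metric_lifting_property X"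
    and T: "T \<in> bounded_ops X Y"
  shows "kolmogorov_diameter n (dual_space Y) (dual_space X) (adjoint_op X T) \<le> kolmogorov_diameter n X Y T"
proof -
  have Y: "normed_space Y" using bY by (auto simp: banach_space_def)
  interpret X: normed_space X by (fact X)
  interpret Y: normed_space Y by (fact Y)
  interpret X': normed_space "dual_space X" using X by (rule normed_space_dual)
  have Y': "normed_space (dual_space Y)" using Y by (rule normed_space_dual)
  note T' = linear_opD[OF bounded_ops_linear[OF T]]
  show ?thesis
  proof (rule Y.kolmogorov_diameter_ge)
    fix B assume B: "finite B" "B \<subseteq> carrier Y" "card B \<le> n"
    define G where "G = lin_span Y B"
    define d where "d = op_norm X (quot_space Y G) (quot_map Y G \<circ> T)"
    \<comment> \<open>The lifting property speaks of closed subspaces only; here the closedness of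
      finite-dimensional spans enters.\<close>
    have G: "closed_subspace G Y" unfolding G_def using B(1,2) by (rule Y.closed_subspace_span)
    then have subG: "lin_subspace G Y" by (simp add: closed_subspace_def)
    have "kolmogorov_diameter n (dual_space Y) (dual_space X) (adjoint_op X T) \<le> (1 + \<epsilon>) * d"
      if \<epsilon>: "0 < \<epsilon>" for \<epsilon>
    proof -
      obtain S where S: "S \<in> bounded_ops X Y" "op_norm X Y S \<le> (1 + \<epsilon>) * d"
        and QS: "\<forall>x\<in>carrier X. quot_map Y G (T x) = quot_map Y G (S x)"
        using lift[unfolded metric_lifting_property_def, rule_format, of Y G "quot_map Y G \<circ> T" \<epsilon>]
          bY G Y.bounded_ops_quot_map_comp[OF X T subG] \<epsilon>
        by (auto simp: d_def)
      note S' = linear_opD[OF bounded_ops_linear[OF S(1)]]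
      have TS: "vsub Y (T x) (S x) \<in> G" if x: "x \<in> carrier X" for x
      proof -
        obtain g where g: "g \<in> G" "T x = vadd Y (S x) g"
          using Y.quot_map_eqD[OF subG T'(1)[OF x]] QS x by blast
        then have "g \<in> carrier Y" using subG by (auto simp: lin_subspace_def)
        then have "vsub Y (T x) (S x) = g"
          using S'(1)[OF x] by (simp add: g Y.add_commute[of "vadd Y (S x) g"] Y.sub_add_cancel)
        then show ?thesis using g by simp
      qed
      define U where "U h = vsub (dual_space X) (adjoint_op X T h) (adjoint_op X S h)" for h
      have linU: "linear_op (dual_space Y) (dual_space X) U"
        unfolding U_def using adjoint_bounded[OF X Y] T S(1)
        by (intro linear_op_sub X'.normed_space_axioms bounded_ops_linear)
      \<comment> \<open>Points of \<open>B\<close> act as functionals on the dual by evaluation.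
        There are at most \<open>card B\<close> of them, as distinct points may give the same
        evaluation.\<close>
      have ev: "linear_op (dual_space Y) scalar_space (\<lambda>h. h b)" for b
        by (auto simp: linear_op_def scalar_space_def)
      \<comment> \<open>\<open>T x - S x\<close> lies in the span of \<open>B\<close>, so a
        functional that vanishes on \<open>B\<close> annihilates it.\<close>
      have "U h = vzero (dual_space X)"
        if h: "h \<in> carrier (dual_space Y)" "\<forall>e\<in>(\<lambda>b h. h b) ` B. e h = 0" for h
      proof
        fix x
        have hb: "h \<in> bounded_ops Y scalar_space" using h by (simp add: dual_carrier_iff)
        have "h (vzero Y) = 0"
          using linear_op_zero[OF Y normed_space_scalar bounded_ops_linear[OF hb]] by (simp add: scalar_space_def)
        then have "lin_subspace {y \<in> carrier Y. h y = 0} Y"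
          unfolding lin_subspace_def using hb by (auto simp: bounded_functional_iff)
        then have "G \<subseteq> {y \<in> carrier Y. h y = 0}"
          unfolding G_def using B h by (intro Y.lin_span_minimal) auto
        then have "h (vsub Y (T x) (S x)) = 0" if "x \<in> carrier X" using TS[OF that] by blast
        then show "U h x = vzero (dual_space X) x"
          using hb T'(1) S'(1) by (auto simp: U_def adjoint_op_def bounded_functional_iff)
      qed
      then obtain C where C: "C \<subseteq> carrier (dual_space X)" "finite C" "card C \<le> card ((\<lambda>b h. h b) ` B :: (('a \<Rightarrow> 'k) \<Rightarrow> 'k) set)"
        "\<forall>h\<in>carrier (dual_space Y). U h \<in> lin_span (dual_space X) C"
        using range_in_span_of_common_kernel[OF Y' X'.normed_space_axioms, of "(\<lambda>b h. h b) ` B" U] B(1) ev linU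
        by blast
      show ?thesis
      proof (rule X'.kolmogorov_diameter_le[OF Y' adjoint_bounded[OF X Y T] C(2,1)])
        show "card C \<le> n" using C(3) card_image_le[OF B(1)] B(3) by (meson order_trans)
        fix h assume h: "h \<in> carrier (dual_space Y)" "vnorm (dual_space Y) h \<le> 1"
        have hb: "h \<in> bounded_ops Y scalar_space" using h by (simp add: dual_carrier_iff)
        \<comment> \<open>The correction \<open>- U h\<close> leaves the adjoint of \<open>S\<close>
          at \<open>h\<close>, whose norm is at most that of \<open>S\<close>.\<close>
        have "vsub (dual_space X) (adjoint_op X T h) (U h) = adjoint_op X S h"
          by (simp add: U_def)
        moreover have "vnorm (dual_space X) (adjoint_op X S h) \<le> (1 + \<epsilon>) * d"
          unfolding dual_space_simps
        proof (rule functional_norm_le[OF X])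
          fix x assume x: "x \<in> carrier X" "vnorm X x \<le> 1"
          have "norm (h (S x)) \<le> op_norm Y scalar_space h * vnorm Y (S x)"
            using functional_norm_bound[OF Y hb] S'(1) x by simp
          also have "\<dots> \<le> 1 * vnorm Y (S x)"
            using h(2) S'(1) x by (intro mult_right_mono) (auto intro: Y.norm_nonneg)
          also have "\<dots> \<le> (1 + \<epsilon>) * d" using op_norm_ge[OF X S(1) x] S(2) by simp
          finally show "norm (adjoint_op X S h x) \<le> (1 + \<epsilon>) * d" using x by (simp add: adjoint_op_def)
        qed
        moreover have "vscale (dual_space X) (-1) (U h) \<in> lin_span (dual_space X) C"
          using C(4) h X'.lin_subspace_span[OF C(1)] unfolding lin_subspace_def by blast
        ultimately show "\<exists>g\<in>lin_span (dual_space X) C.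
            vnorm (dual_space X) (vadd (dual_space X) (adjoint_op X T h) g) \<le> (1 + \<epsilon>) * d"
          by metis
      qed
    qed
    \<comment> \<open>The factor \<open>1 + \<epsilon>\<close> is removed by letting
      \<open>\<epsilon>\<close> tend to zero from the right.\<close>
    then have "\<forall>\<^sub>F \<epsilon> in at_right 0.
        kolmogorov_diameter n (dual_space Y) (dual_space X) (adjoint_op X T) \<le> (1 + \<epsilon>) * d"
      by (intro eventually_at_rightI[of 0 1]) auto
    moreover have "((\<lambda>\<epsilon>. (1 + \<epsilon>) * d) \<longlongrightarrow> (1 + 0) * d) (at_right 0)"
      by (intro tendsto_intros)
    ultimately have "kolmogorov_diameter n (dual_space Y) (dual_space X) (adjoint_op X T) \<le> (1 + 0) * d"
      by (intro tendsto_lowerbound) auto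
    then show "kolmogorov_diameter n (dual_space Y) (dual_space X) (adjoint_op X T)
        \<le> op_norm X (quot_space Y (lin_span Y B)) (quot_map Y (lin_span Y B) \<circ> T)"
      by (simp add: d_def G_def)
  qed
qed

theorem theorem4p10:
  fixes X Y :: "('k::real_normed_field, 'a) nspace"
    and T :: "'a \<Rightarrow> 'a"
    and n :: nat
  assumes "banach_space X" and "banach_space Y"
    and "metric_lifting_property X"
    and "metric_extension_property Y"
    and "T \<in> bounded_ops X Y"
  shows "kolmogorov_diameter n (dual_space Y) (dual_space X) (adjoint_op X T)
    = kolmogorov_diameter n X Y T"
proof (rule antisym)
  have "normed_space X" using assms(1) by (simp add: banach_space_def)
  then show "kolmogorov_diameter n (dual_space Y) (dual_space X) (adjoint_op X T) \<le> kolmogorov_diameter n X Y T"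
    using assms by (intro kolmogorov_diameter_adjoint_le)
  show "kolmogorov_diameter n X Y T \<le> kolmogorov_diameter n (dual_space Y) (dual_space X) (adjoint_op X T)"
    using assms by (intro kolmogorov_diameter_adjoint_ge)
qed

end
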